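(* Let $\mathfrak{M}=(V,\langle\cdot,\cdot\rangle,A)$ be a model of neutral signature $(2,2)$. Then the following conditions are equivalent: (1) $\mathfrak{M}$ is spacelike Osserman. (2) $\mathfrak{M}$ is timelike Osserman. (3) $\mathfrak{M}$ is spacelike Jordan Osserman. (4) $\mathfrak{M}$ is timelike Jordan Osserman. (5) $\mathfrak{M}$ is Einstein and is self-dual for a suitably chosen orientation of $V$. (6) $\mathfrak{M}$ is null Osserman.
   Context: A model of signature $(2,2)$ is a triple $\mathfrak{M}=(V,\langle\cdot,\cdot\rangle,A)$, where $V$ is a $4$-dimensional real vector space, $\langle\cdot,\cdot\rangle$ is a non-degenerate symmetric bilinear form on $V$ of signature $(2,2)$, and $A\in\otimes^4(V^* )$ is an algebraic curvature tensor, i.e. for all $x,y,z,v$: $A(x,y,z,v)=-A(y,x,z,v)=A(z,v,x,y)$ and $A(x,y,z,v)+A(y,z,x,v)+A(z,x,y,v)=0$. The Jacobi operator $\mathcal{J}_A(x):V\to V$ is characterized by $\langle\mathcal{J}_A(x)y,z\rangle=A(y,x,x,z)$. A vector $v$ is spacelike, timelike or null if $\langle v,v\rangle>0$, $<0$, or $=0$. Let $S^{\pm}(V,\langle\cdot,\cdot\rangle)=\{v:\langle v,v\rangle=\pm1\}$ and let $N(V,\langle\cdot,\cdot\rangle)$ be the set of non-zero null vectors. $\mathfrak{M}$ is spacelike (resp. timelike, null) Osserman if the (complex) eigenvalues of $\mathcal{J}_A(v)$, counted with multiplicity, are independent of $v$ in $S^+$ (resp. $S^-$, $N$). $\mathfrak{M}$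 is spacelike (resp. timelike) Jordan Osserman if the Jordan normal form of $\mathcal{J}_A(v)$ is independent of $v$ in $S^+$ (resp. $S^-$). For a basis $\{e_i\}$ of $V$ let $g_{ij}=\langle e_i,e_j\rangle$ with inverse matrix $g^{ij}$. Set $\rho_A(x,y)=\sum_{i,j}g^{ij}A(e_i,x,y,e_j)$ and $\tau_A=\sum_{i,j}g^{ij}\rho_A(e_i,e_j)$. $\mathfrak{M}$ is Einstein if $\rho_A=c\langle\cdot,\cdot\rangle$ for some $c\in\mathbb{R}$. The Weyl tensor is $$W_A(x,y,z,v)=A(x,y,z,v)+\tfrac16\tau_A\{\langle y,z\rangle\langle x,v\rangle-\langle x,z\rangle\langle y,v\rangle\}-\tfrac12\{\rho_A(y,z)\langle x,v\rangle-\rho_A(x,z)\langle y,v\rangle+\rho_A(x,v)\langle y,z\rangle-\rho_A(y,v)\langle x,z\rangle\},$$ regarded as an endomorphism of $\Lambda^2(V^* )$ via the induced inner product. Given an orientation of $V$, take an oriented orthonormal basis $\{e_1,e_2,e_3,e_4\}$ with $e_1,e_2$ timelike and $e_3,e_4$ spacelike, and let $\{e^i\}$ be the dual basis. The Hodge operator $\star$ on $\Lambda^2(V^* )$ is characterized by $\phi\wedge\star\theta=\langle\phi,\theta\rangle e^1\wedge e^2\wedge e^3\wedge e^4$. It satisfies $\star^2=\mathrm{id}$; let $\Lambda^{\pm}$ be its $\pm1$ eigenspaces. $W_A$ preserves $\Lambda^\pm$; let $W_A^{\pm}$ be its restriction to $\Lambda^\pm$. $\mathfrak{M}$ is self-dual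 (for the given orientation) if $W_A^-=0$. *)

theory Defs
  imports
    "HOL-Analysis.Analysis"
    "HOL-Combinatorics.Permutations"
    "Jordan_Normal_Form.Jordan_Normal_Form"
begin

hide_const (open) Determinant.det Matrix.mat
no_notation Matrix.vec_index (infixl "$" 100)

section \<open>Ordered bases and operators\<close>

text \<open>Ordered bases of a 4-dimensional space are families indexed by the numeral type 4, whose
  elements are 1, 2, 3 and 4 (with 4 = 0).\<close>

definition is_basis :: "(4 \<Rightarrow> 'v::real_vector) \<Rightarrow> bool" where
  "is_basis e \<longleftrightarrow> inj e \<and> independent (range e) \<and> span (range e) = UNIV"

definition coord :: "(4 \<Rightarrow> 'v::real_vector) \<Rightarrow> 4 \<Rightarrow> 'v \<Rightarrow> real" where
  "coord e i v = representation (range e) v (e i)"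

text \<open>Traces, eigenvalues and Jordan forms below are computed in an arbitrarily chosen ordered
  basis; none of them depends on the choice (see \<open>complex_eigenvalues_eq\<close>, \<open>has_jordan_form_iff\<close> and
  \<open>contract_eq\<close>).\<close>

definition some_basis :: "4 \<Rightarrow> 'v::real_vector" where
  "some_basis = (SOME e. is_basis e)"

text \<open>The matrix of a real operator, viewed as a complex matrix. Matrix indices start at 0.\<close>

definition op_mat :: "(4 \<Rightarrow> 'v::real_vector) \<Rightarrow> ('v \<Rightarrow> 'v) \<Rightarrow> complex mat" where
  "op_mat e L = Matrix.mat 4 4 (\<lambda>(i, j).
     complex_of_real (coord e (of_nat (Suc i)) (L (e (of_nat (Suc j))))))"

definition complex_eigenvalues :: "('v::real_vector \<Rightarrow> 'v) \<Rightarrow> complex multiset" where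
  "complex_eigenvalues L = proots (char_poly (op_mat some_basis L))"

text \<open>A list of pairs (size, eigenvalue) is a Jordan normal form of \<open>L\<close>; the order of the blocks
  is immaterial.\<close>

definition has_jordan_form :: "('v::real_vector \<Rightarrow> 'v) \<Rightarrow> (nat \<times> complex) list \<Rightarrow> bool" where
  "has_jordan_form L n_as \<longleftrightarrow> jordan_nf (op_mat some_basis L) n_as"

section \<open>Models of signature (2,2)\<close>

definition orthonormal_basis :: "('v::real_vector \<Rightarrow> 'v \<Rightarrow> real) \<Rightarrow> (4 \<Rightarrow> 'v) \<Rightarrow> bool" where
  "orthonormal_basis ip e \<longleftrightarrow> is_basis e \<and> (\<forall>i j. i \<noteq> j \<longrightarrow> ip (e i) (e j) = 0) \<and>
     ip (e 1) (e 1) = -1 \<and> ip (e 2) (e 2) = -1 \<and> ip (e 3) (e 3) = 1 \<and> ip (e 4) (e 4) = 1"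

definition neutral_inner_product :: "('v::real_vector \<Rightarrow> 'v \<Rightarrow> real) \<Rightarrow> bool" where
  "neutral_inner_product ip \<longleftrightarrow> bilinear ip \<and> (\<forall>x y. ip x y = ip y x) \<and>
     (\<forall>x. (\<forall>y. ip x y = 0) \<longrightarrow> x = 0) \<and> (\<exists>e. orthonormal_basis ip e)"

definition curvature_tensor :: "('v::real_vector \<Rightarrow> 'v \<Rightarrow> 'v \<Rightarrow> 'v \<Rightarrow> real) \<Rightarrow> bool" where
  "curvature_tensor A \<longleftrightarrow>
     (\<forall>y z v. linear (\<lambda>x. A x y z v)) \<and> (\<forall>x z v. linear (\<lambda>y. A x y z v)) \<and>
     (\<forall>x y v. linear (\<lambda>z. A x y z v)) \<and> (\<forall>x y z. linear (\<lambda>v. A x y z v)) \<and>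
     (\<forall>x y z v. A x y z v = - A y x z v) \<and>
     (\<forall>x y z v. A x y z v = A z v x y) \<and>
     (\<forall>x y z v. A x y z v + A y z x v + A z x y v = 0)"

definition neutral_model ::
  "('v::real_vector \<Rightarrow> 'v \<Rightarrow> real) \<Rightarrow> ('v \<Rightarrow> 'v \<Rightarrow> 'v \<Rightarrow> 'v \<Rightarrow> real) \<Rightarrow> bool" where
  "neutral_model ip A \<longleftrightarrow>
     dim (UNIV :: 'v set) = 4 \<and> neutral_inner_product ip \<and> curvature_tensor A"

definition jacobi_op ::
  "('v::real_vector \<Rightarrow> 'v \<Rightarrow> real) \<Rightarrow> ('v \<Rightarrow> 'v \<Rightarrow> 'v \<Rightarrow> 'v \<Rightarrow> real) \<Rightarrow> 'v \<Rightarrow> 'v \<Rightarrow> 'v" where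
  "jacobi_op ip A x y = (THE w. \<forall>z. ip w z = A y x x z)"

section \<open>Osserman conditions\<close>

definition unit_spacelike :: "('v::real_vector \<Rightarrow> 'v \<Rightarrow> real) \<Rightarrow> 'v set" where
  "unit_spacelike ip = {v. ip v v = 1}"

definition unit_timelike :: "('v::real_vector \<Rightarrow> 'v \<Rightarrow> real) \<Rightarrow> 'v set" where
  "unit_timelike ip = {v. ip v v = -1}"

definition null_vectors :: "('v::real_vector \<Rightarrow> 'v \<Rightarrow> real) \<Rightarrow> 'v set" where
  "null_vectors ip = {v. v \<noteq> 0 \<and> ip v v = 0}"

definition osserman_on ::
  "'v set \<Rightarrow> ('v::real_vector \<Rightarrow> 'v \<Rightarrow> real) \<Rightarrow> ('v \<Rightarrow> 'v \<Rightarrow> 'v \<Rightarrow> 'v \<Rightarrow> real) \<Rightarrow> bool" where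
  "osserman_on S ip A \<longleftrightarrow> (\<exists>E. \<forall>v\<in>S. complex_eigenvalues (jacobi_op ip A v) = E)"

definition jordan_osserman_on ::
  "'v set \<Rightarrow> ('v::real_vector \<Rightarrow> 'v \<Rightarrow> real) \<Rightarrow> ('v \<Rightarrow> 'v \<Rightarrow> 'v \<Rightarrow> 'v \<Rightarrow> real) \<Rightarrow> bool" where
  "jordan_osserman_on S ip A \<longleftrightarrow> (\<exists>n_as. \<forall>v\<in>S. has_jordan_form (jacobi_op ip A v) n_as)"

definition "spacelike_osserman ip A \<longleftrightarrow> osserman_on (unit_spacelike ip) ip A"
definition "timelike_osserman ip A \<longleftrightarrow> osserman_on (unit_timelike ip) ip A"
definition "null_osserman ip A \<longleftrightarrow> osserman_on (null_vectors ip) ip A"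
definition "spacelike_jordan_osserman ip A \<longleftrightarrow> jordan_osserman_on (unit_spacelike ip) ip A"
definition "timelike_jordan_osserman ip A \<longleftrightarrow> jordan_osserman_on (unit_timelike ip) ip A"

section \<open>Ricci and Weyl tensors\<close>

definition gram :: "('v::real_vector \<Rightarrow> 'v \<Rightarrow> real) \<Rightarrow> (4 \<Rightarrow> 'v) \<Rightarrow> real^4^4" where
  "gram ip e = (\<chi> i j. ip (e i) (e j))"

definition contract_wrt ::
  "(4 \<Rightarrow> 'v) \<Rightarrow> ('v::real_vector \<Rightarrow> 'v \<Rightarrow> real) \<Rightarrow> ('v \<Rightarrow> 'v \<Rightarrow> real) \<Rightarrow> real" where
  "contract_wrt e ip T = (\<Sum>i\<in>UNIV. \<Sum>j\<in>UNIV. matrix_inv (gram ip e) $ i $ j * T (e i) (e j))"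

definition contract :: "('v::real_vector \<Rightarrow> 'v \<Rightarrow> real) \<Rightarrow> ('v \<Rightarrow> 'v \<Rightarrow> real) \<Rightarrow> real" where
  "contract = contract_wrt some_basis"

definition ricci ::
  "('v::real_vector \<Rightarrow> 'v \<Rightarrow> real) \<Rightarrow> ('v \<Rightarrow> 'v \<Rightarrow> 'v \<Rightarrow> 'v \<Rightarrow> real) \<Rightarrow> 'v \<Rightarrow> 'v \<Rightarrow> real" where
  "ricci ip A x y = contract ip (\<lambda>u w. A u x y w)"

definition scalar_curvature ::
  "('v::real_vector \<Rightarrow> 'v \<Rightarrow> real) \<Rightarrow> ('v \<Rightarrow> 'v \<Rightarrow> 'v \<Rightarrow> 'v \<Rightarrow> real) \<Rightarrow> real" where
  "scalar_curvature ip A = contract ip (ricci ip A)"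

definition einstein ::
  "('v::real_vector \<Rightarrow> 'v \<Rightarrow> real) \<Rightarrow> ('v \<Rightarrow> 'v \<Rightarrow> 'v \<Rightarrow> 'v \<Rightarrow> real) \<Rightarrow> bool" where
  "einstein ip A \<longleftrightarrow> (\<exists>c. \<forall>x y. ricci ip A x y = c * ip x y)"

definition weyl ::
  "('v::real_vector \<Rightarrow> 'v \<Rightarrow> real) \<Rightarrow> ('v \<Rightarrow> 'v \<Rightarrow> 'v \<Rightarrow> 'v \<Rightarrow> real)
    \<Rightarrow> 'v \<Rightarrow> 'v \<Rightarrow> 'v \<Rightarrow> 'v \<Rightarrow> real" where
  "weyl ip A x y z v = A x y z v
     + 1/6 * scalar_curvature ip A * (ip y z * ip x v - ip x z * ip y v)
     - 1/2 * (ricci ip A y z * ip x v - ricci ip A x z * ip y v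
              + ricci ip A x v * ip y z - ricci ip A y v * ip x z)"

section \<open>Two-forms, the Hodge operator and self-duality\<close>

definition two_forms :: "('v::real_vector \<Rightarrow> 'v \<Rightarrow> real) set" where
  "two_forms = {\<phi>. bilinear \<phi> \<and> (\<forall>x y. \<phi> x y = - \<phi> y x)}"

text \<open>The factor 1/2 makes the inner product of \<open>\<alpha> \<and> \<beta>\<close> and \<open>\<gamma> \<and> \<delta>\<close> the determinant of
  the matrix of inner products of \<open>\<alpha>, \<beta>\<close> with \<open>\<gamma>, \<delta>\<close>.\<close>

definition form_ip ::
  "('v::real_vector \<Rightarrow> 'v \<Rightarrow> real) \<Rightarrow> ('v \<Rightarrow> 'v \<Rightarrow> real) \<Rightarrow> ('v \<Rightarrow> 'v \<Rightarrow> real) \<Rightarrow> real" where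
  "form_ip ip \<phi> \<theta> = 1/2 * contract ip (\<lambda>a b. contract ip (\<lambda>c d. \<phi> a c * \<theta> b d))"

text \<open>The Weyl tensor lies in the tensor square of the two-forms; it acts on two-forms by
  contracting its first factor with the induced inner product.\<close>

definition weyl_op ::
  "('v::real_vector \<Rightarrow> 'v \<Rightarrow> real) \<Rightarrow> ('v \<Rightarrow> 'v \<Rightarrow> 'v \<Rightarrow> 'v \<Rightarrow> real)
    \<Rightarrow> ('v \<Rightarrow> 'v \<Rightarrow> real) \<Rightarrow> ('v \<Rightarrow> 'v \<Rightarrow> real)" where
  "weyl_op ip A \<phi> = (\<lambda>x y. form_ip ip \<phi> (\<lambda>z v. weyl ip A z v x y))"

text \<open>Four-forms are evaluated at a family of vectors indexed by 4. The factor 1/4 is the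
  1/(p! q!) of the wedge product for p = q = 2.\<close>

definition wedge ::
  "('v::real_vector \<Rightarrow> 'v \<Rightarrow> real) \<Rightarrow> ('v \<Rightarrow> 'v \<Rightarrow> real) \<Rightarrow> (4 \<Rightarrow> 'v) \<Rightarrow> real" where
  "wedge \<phi> \<psi> x = 1/4 * (\<Sum>p | p permutes (UNIV :: 4 set).
     of_int (sign p) * \<phi> (x (p 1)) (x (p 2)) * \<psi> (x (p 3)) (x (p 4)))"

text \<open>The wedge product of the four elements of the basis dual to \<open>e\<close>.\<close>

definition vol_form :: "(4 \<Rightarrow> 'v::real_vector) \<Rightarrow> (4 \<Rightarrow> 'v) \<Rightarrow> real" where
  "vol_form e x = det (\<chi> i j. coord e i (x j))"

text \<open>An orientation is an equivalence class of ordered bases, two of them being equivalent if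
  the change of basis has positive determinant.\<close>

definition same_orientation :: "((4 \<Rightarrow> 'v::real_vector) \<times> (4 \<Rightarrow> 'v)) set" where
  "same_orientation = {(e, f). is_basis e \<and> is_basis f \<and> det (\<chi> i j. coord e i (f j)) > 0}"

definition orientations :: "(4 \<Rightarrow> 'v::real_vector) set set" where
  "orientations = {e. is_basis e} // same_orientation"

definition hodge ::
  "('v::real_vector \<Rightarrow> 'v \<Rightarrow> real) \<Rightarrow> (4 \<Rightarrow> 'v) set \<Rightarrow> ('v \<Rightarrow> 'v \<Rightarrow> real) \<Rightarrow> ('v \<Rightarrow> 'v \<Rightarrow> real)" where
  "hodge ip Or \<theta> = (THE \<psi>. \<psi> \<in> two_forms \<and>
     (\<forall>e\<in>Or. orthonormal_basis ip e \<longrightarrow>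
       (\<forall>\<phi>\<in>two_forms. \<forall>x. wedge \<phi> \<psi> x = form_ip ip \<phi> \<theta> * vol_form e x)))"

definition anti_self_dual_forms ::
  "('v::real_vector \<Rightarrow> 'v \<Rightarrow> real) \<Rightarrow> (4 \<Rightarrow> 'v) set \<Rightarrow> ('v \<Rightarrow> 'v \<Rightarrow> real) set" where
  "anti_self_dual_forms ip Or = {\<phi> \<in> two_forms. hodge ip Or \<phi> = (\<lambda>x y. - \<phi> x y)}"

definition self_dual ::
  "('v::real_vector \<Rightarrow> 'v \<Rightarrow> real) \<Rightarrow> ('v \<Rightarrow> 'v \<Rightarrow> 'v \<Rightarrow> 'v \<Rightarrow> real) \<Rightarrow> (4 \<Rightarrow> 'v) set \<Rightarrow> bool" where
  "self_dual ip A Or \<longleftrightarrow> (\<forall>\<phi> \<in> anti_self_dual_forms ip Or. weyl_op ip A \<phi> = (\<lambda>x y. 0))"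

section \<open>Independence of the chosen basis\<close>

lemma coord_expand:
  fixes e :: "4 \<Rightarrow> 'v::real_vector"
  assumes "is_basis e"
  shows "(\<Sum>i\<in>UNIV. coord e i v *\<^sub>R e i) = v"
proof -
  have e: "inj e" "independent (range e)" "span (range e) = UNIV"
    using assms by (auto simp: is_basis_def)
  have "(\<Sum>b\<in>range e. representation (range e) v b *\<^sub>R b) = v"
    using real_vector.sum_representation_eq[of "range e" v "range e"] e by auto
  then show ?thesis
    using e(1) by (simp add: coord_def sum.reindex)
qed

lemma linear_coord:
  assumes "is_basis e"
  shows "linear (coord e i)"
  using assms by (intro linearI)
    (auto simp: coord_def is_basis_def real_vector.representation_add real_vector.representation_scale)

lemma coord_basis:
  assumes "is_basis e"
  shows "coord e i (e j) = (if i = j then 1 else 0)"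
  using assms unfolding coord_def is_basis_def
  by (subst real_vector.representation_basis) (auto simp: inj_eq)

lemma coord_change:
  assumes "is_basis e" "is_basis f"
  shows "(\<Sum>k\<in>UNIV. coord e i (f k) * coord f k v) = coord e i v"
proof -
  have "coord e i v = coord e i (\<Sum>k\<in>UNIV. coord f k v *\<^sub>R f k)"
    using coord_expand[OF assms(2)] by simp
  also have "\<dots> = (\<Sum>k\<in>UNIV. coord e i (f k) * coord f k v)"
    using linear_coord[OF assms(1)] by (simp add: linear_sum linear_cmul mult.commute)
  finally show ?thesis by simp
qed

lemma is_basis_some_basis:
  fixes e :: "4 \<Rightarrow> 'v::real_vector"
  assumes "is_basis e"
  shows "is_basis (some_basis :: 4 \<Rightarrow> 'v)"
  unfolding some_basis_def using assms by (metis someI_ex)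

lemma bilinear_change:
  assumes "is_basis e" "bilinear T"
  shows "(\<chi> i j. T (f i) (f j)) =
    transpose (\<chi> i j. coord e i (f j)) ** (\<chi> i j. T (e i) (e j)) ** (\<chi> i j. coord e i (f j))"
proof -
  have T: "T v w = (\<Sum>i\<in>UNIV. \<Sum>j\<in>UNIV. coord e i v * (T (e i) (e j) * coord e j w))" for v w
  proof -
    have lin: "linear (T x)" "linear (\<lambda>x. T x y)" for x y
      using assms(2) by (auto simp: bilinear_def)
    have "T v w = T (\<Sum>i\<in>UNIV. coord e i v *\<^sub>R e i) w"
      by (simp only: coord_expand[OF assms(1)])
    also have "\<dots> = (\<Sum>i\<in>UNIV. coord e i v * T (e i) w)"
      by (simp add: linear_sum[OF lin(2)] linear_cmul[OF lin(2)])
    also have "\<dots> = (\<Sum>i\<in>UNIV. coord e i v * T (e i) (\<Sum>j\<in>UNIV. coord e j w *\<^sub>R e j))"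
      by (simp only: coord_expand[OF assms(1)])
    also have "\<dots> = (\<Sum>i\<in>UNIV. coord e i v * (\<Sum>j\<in>UNIV. T (e i) (e j) * coord e j w))"
      by (simp only: linear_sum[OF lin(1)] linear_cmul[OF lin(1)] real_scaleR_def mult.commute)
    finally show ?thesis by (simp only: sum_distrib_left)
  qed
  show ?thesis
    by (subst matrix_mul_assoc[symmetric])
      (simp add: matrix_matrix_mult_def transpose_def Finite_Cartesian_Product.vec_eq_iff T[of "f _"] sum_distrib_left)
qed

lemma matrix_inv_inverse:
  fixes G :: "real^'n^'n"
  assumes "invertible G"
  shows "G ** matrix_inv G = mat 1 \<and> matrix_inv G ** G = mat 1"
  using assms unfolding invertible_def matrix_inv_def by (rule someI_ex)

lemma matrix_inv_eqI:
  fixes G H :: "real^'n^'n"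
  assumes "G ** H = mat 1" "H ** G = mat 1"
  shows "matrix_inv G = H"
proof -
  have G: "matrix_inv G ** G = mat 1"
    using matrix_inv_inverse[of G] assms by (auto simp: invertible_def)
  have "matrix_inv G = matrix_inv G ** (G ** H)" by (simp only: assms(1) matrix_mul_rid)
  also have "\<dots> = H" by (simp only: matrix_mul_assoc G matrix_mul_lid)
  finally show ?thesis .
qed

lemma contract_wrt_cong:
  assumes ip: "neutral_inner_product ip" and T: "bilinear T" and e: "is_basis e" and f: "is_basis f"
  shows "contract_wrt e ip T = contract_wrt f ip T"
proof -
  define P where "P = (\<chi> i j. coord e i (f j))"
  define Q where "Q = (\<chi> i j. coord f i (e j))"
  have PQ: "P ** Q = mat 1"
    using coord_change[OF e f] coord_basis[OF e]
    by (simp add: P_def Q_def matrix_matrix_mult_def Finite_Cartesian_Product.mat_def Finite_Cartesian_Product.vec_eq_iff)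
  then have QP: "Q ** P = mat 1" by (rule matrix_left_right_inverse1)
  have TPQ: "transpose P ** transpose Q = mat 1" "transpose Q ** transpose P = mat 1"
    by (simp_all only: matrix_transpose_mul[symmetric] PQ QP transpose_mat)
  define G where "G = gram ip e"
  have bil: "bilinear ip" using ip by (simp add: neutral_inner_product_def)
  have F: "gram ip f = transpose P ** G ** P"
    using bilinear_change[OF e bil] by (simp add: gram_def P_def G_def)
  have "invertible G"
  proof -
    have "x = 0" if "G *v x = 0" for x
    proof -
      define w where "w = (\<Sum>i\<in>UNIV. x $ i *\<^sub>R e i)"
      have "ip (e i) w = 0" for i
      proof -
        have "ip (e i) w = (G *v x) $ i"
          using bil by (simp add: w_def G_def gram_def matrix_vector_mult_def bilinear_def
              linear_sum linear_cmul mult.commute)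
        then show ?thesis using that by simp
      qed
      then have "ip (\<Sum>i\<in>UNIV. coord e i v *\<^sub>R e i) w = 0" for v
        using bil by (simp add: bilinear_def linear_sum[of "\<lambda>x. ip x w"] linear_cmul[of "\<lambda>x. ip x w"])
      then have z: "ip v w = 0" for v by (simp add: coord_expand[OF e])
      have "ip w v = 0" for v
        using z[of v] ip by (simp add: neutral_inner_product_def)
      then have w0: "w = 0" using ip by (simp add: neutral_inner_product_def)
      have "coord e j w = x $ j" for j
        using linear_coord[OF e] by (simp add: w_def linear_sum linear_cmul coord_basis[OF e] if_distrib cong: if_cong)
      then have "x $ j = 0" for j
        using linear_0[OF linear_coord[OF e, of j]] by (simp add: w0)
      then show "x = 0" by (simp add: Finite_Cartesian_Product.vec_eq_iff)
    qed
    then have "\<forall>x. G *v x = 0 \<longrightarrow> x = 0" by simp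
    then have "\<exists>B. B ** G = mat 1" by (rule matrix_left_invertible_ker[THEN iffD2])
    then show ?thesis by (rule invertible_left_inverse[THEN iffD2])
  qed
  have Gi: "G ** matrix_inv G = mat 1" "matrix_inv G ** G = mat 1"
    using matrix_inv_inverse[OF \<open>invertible G\<close>] by blast+
  have inv: "matrix_inv (gram ip f) = Q ** matrix_inv G ** transpose Q"
  proof (rule matrix_inv_eqI)
    have "gram ip f ** (Q ** matrix_inv G ** transpose Q)
      = transpose P ** (G ** (P ** Q) ** matrix_inv G) ** transpose Q"
      by (simp only: F matrix_mul_assoc)
    then show "gram ip f ** (Q ** matrix_inv G ** transpose Q) = mat 1"
      by (simp only: PQ Gi TPQ matrix_mul_rid matrix_mul_lid)
    have "(Q ** matrix_inv G ** transpose Q) ** gram ip f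
      = Q ** (matrix_inv G ** (transpose Q ** transpose P) ** G) ** P"
      by (simp only: F matrix_mul_assoc)
    then show "(Q ** matrix_inv G ** transpose Q) ** gram ip f = mat 1"
      by (simp only: QP Gi TPQ matrix_mul_rid matrix_mul_lid)
  qed
  have tr: "contract_wrt h ip T = trace (matrix_inv (gram ip h) ** transpose (\<chi> i j. T (h i) (h j)))" for h
    unfolding contract_wrt_def trace_def matrix_matrix_mult_def transpose_def
    by (simp only: vec_lambda_beta)
  define S where "S = (\<chi> i j. T (e i) (e j))"
  have "contract_wrt f ip T =
    trace (Q ** matrix_inv G ** transpose Q ** transpose (transpose P ** S ** P))"
    by (simp only: tr[of f] inv bilinear_change[OF e T, of f] S_def P_def)
  also have "transpose (transpose P ** S ** P) = transpose P ** (transpose S ** P)"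
    by (simp only: matrix_transpose_mul Finite_Cartesian_Product.transpose_transpose)
  also have "Q ** matrix_inv G ** transpose Q ** (transpose P ** (transpose S ** P))
    = Q ** (matrix_inv G ** (transpose Q ** transpose P) ** transpose S ** P)"
    by (simp only: matrix_mul_assoc)
  also have "\<dots> = Q ** (matrix_inv G ** transpose S ** P)"
    by (simp only: TPQ matrix_mul_rid)
  also have "trace \<dots> = trace (matrix_inv G ** transpose S ** P ** Q)"
    by (rule trace_mul_sym)
  also have "matrix_inv G ** transpose S ** P ** Q = matrix_inv G ** transpose S ** (P ** Q)"
    by (simp only: matrix_mul_assoc)
  also have "trace \<dots> = contract_wrt e ip T"
    by (simp only: PQ matrix_mul_rid tr[of e] G_def S_def)
  finally show ?thesis by simp
qed

lemma contract_eq: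
  assumes "neutral_inner_product ip" "bilinear T" "is_basis e"
  shows "contract ip T = contract_wrt e ip T"
  unfolding contract_def using contract_wrt_cong assms is_basis_some_basis by metis

lemma sum_4_nat: "(\<Sum>i = 0..<4. g (of_nat (Suc i) :: 4)) = (\<Sum>i\<in>UNIV. g i)"
  by (simp add: sum_4 eval_nat_numeral add.assoc[symmetric])

lemma similar_op_mat:
  assumes L: "linear L" and e: "is_basis e" and f: "is_basis f"
  shows "similar_mat (op_mat e L) (op_mat f L)"
proof -
  define C :: "(4 \<Rightarrow> 'a) \<Rightarrow> (4 \<Rightarrow> 'a) \<Rightarrow> complex mat" where
    "C e f = Matrix.mat 4 4 (\<lambda>(i, j). complex_of_real (coord e (of_nat (Suc i)) (f (of_nat (Suc j)))))"
    for e f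
  have op: "op_mat e L = C e (L \<circ> e)" for e by (simp add: op_mat_def C_def)
  have mul: "C e f * C f h = C e h" if "is_basis e" "is_basis f" for e f h
  proof (rule eq_matI)
    fix i j assume ij: "i < dim_row (C e h)" "j < dim_col (C e h)"
    then have "(C e f * C f h) $$ (i, j) = (\<Sum>k = 0..<4. complex_of_real
        (coord e (of_nat (Suc i)) (f (of_nat (Suc k))) * coord f (of_nat (Suc k)) (h (of_nat (Suc j)))))"
      by (simp add: C_def scalar_prod_def del: of_nat_Suc)
    also have "\<dots> = complex_of_real (coord e (of_nat (Suc i)) (h (of_nat (Suc j))))"
      using sum_4_nat[of "\<lambda>k. coord e (of_nat (Suc i)) (f k) * coord f k (h (of_nat (Suc j)))"]
      by (simp only: of_real_sum[symmetric] coord_change[OF that])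
    finally show "(C e f * C f h) $$ (i, j) = C e h $$ (i, j)"
      using ij by (simp add: C_def del: of_nat_Suc)
  qed (simp_all add: C_def)
  have inj4: "of_nat (Suc i) = (of_nat (Suc j) :: 4) \<longleftrightarrow> i = j" if "i < 4" "j < 4" for i j
  proof -
    have "i \<in> {0,1,2,3}" "j \<in> {0,1,2,3}" using that by auto
    then show ?thesis by auto
  qed
  have one: "C e e = 1\<^sub>m 4" if "is_basis e" for e
    by (rule eq_matI) (auto simp: C_def coord_basis[OF that] inj4 simp del: of_nat_Suc)
  have Lmul: "C e (L \<circ> e) * C e f = C e (L \<circ> f)" if "is_basis e" for e f
  proof (rule eq_matI)
    fix i j assume ij: "i < dim_row (C e (L \<circ> f))" "j < dim_col (C e (L \<circ> f))"
    let ?i = "of_nat (Suc i) :: 4" and ?w = "f (of_nat (Suc j))"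
    from ij have "(C e (L \<circ> e) * C e f) $$ (i, j) = (\<Sum>k = 0..<4. complex_of_real
        (coord e ?i (L (e (of_nat (Suc k)))) * coord e (of_nat (Suc k)) ?w))"
      by (simp add: C_def scalar_prod_def del: of_nat_Suc)
    also have "\<dots> = complex_of_real (\<Sum>k\<in>UNIV. coord e ?i (L (e k)) * coord e k ?w)"
      using sum_4_nat[of "\<lambda>k. coord e ?i (L (e k)) * coord e k ?w"]
      by (simp only: of_real_sum[symmetric])
    also have "(\<Sum>k\<in>UNIV. coord e ?i (L (e k)) * coord e k ?w)
      = coord e ?i (L (\<Sum>k\<in>UNIV. coord e k ?w *\<^sub>R e k))"
      using linear_coord[OF that] L by (simp add: linear_sum linear_cmul mult.commute)
    also have "\<dots> = coord e ?i (L ?w)" by (simp only: coord_expand[OF that])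
    finally show "(C e (L \<circ> e) * C e f) $$ (i, j) = C e (L \<circ> f) $$ (i, j)"
      using ij by (simp add: C_def del: of_nat_Suc)
  qed (simp_all add: C_def)
  have car: "C e f \<in> carrier_mat 4 4" for e f by (simp add: C_def)
  have "C e f * C f (L \<circ> f) * C f e = C e f * (C f (L \<circ> f) * C f e)"
    by (rule assoc_mult_mat[OF car car car])
  also have "\<dots> = C e (L \<circ> e)" by (simp only: Lmul[OF f] mul[OF e f])
  finally have "C e f * C f (L \<circ> f) * C f e = C e (L \<circ> e)" .
  then have "similar_mat_wit (op_mat e L) (op_mat f L) (C e f) (C f e)"
    using car mul[OF e f] mul[OF f e] one[OF e] one[OF f]
    by (intro similar_mat_witI[of _ _ 4]) (simp_all add: op)
  then show ?thesis by (auto simp: similar_mat_def)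
qed

lemma complex_eigenvalues_eq:
  assumes "linear L" "is_basis e"
  shows "complex_eigenvalues L = proots (char_poly (op_mat e L))"
  unfolding complex_eigenvalues_def
  by (subst char_poly_similar[OF similar_op_mat[OF assms(1) is_basis_some_basis[OF assms(2)] assms(2)]])
    (rule refl)

lemma has_jordan_form_iff:
  assumes "linear L" "is_basis e"
  shows "has_jordan_form L n_as \<longleftrightarrow> jordan_nf (op_mat e L) n_as"
proof -
  have s: "similar_mat (op_mat some_basis L) (op_mat e L)"
    by (rule similar_op_mat[OF assms(1) is_basis_some_basis[OF assms(2)] assms(2)])
  show ?thesis
    unfolding has_jordan_form_def jordan_nf_def
    using similar_mat_trans[OF s] similar_mat_trans[OF similar_mat_sym[OF s]] by blast
qed

end

theory Submission
  imports Defs "Jordan_Normal_Form.Jordan_Normal_Form_Existence"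
begin

hide_const (open) Determinant.det Matrix.mat
no_notation Matrix.vec_index (infixl "$" 100)

text \<open>
  The bridge between all six conditions is the splitting of the two-forms into self-dual and
  anti-self-dual ones. In an orthonormal frame the forms \<open>e\<^sub>1\<^sub>2 \<plusminus> e\<^sub>3\<^sub>4\<close>, \<open>e\<^sub>1\<^sub>3 \<plusminus> e\<^sub>2\<^sub>4\<close>,
  \<open>e\<^sub>1\<^sub>4 \<minusplus> e\<^sub>2\<^sub>3\<close> span the two summands, and the curvature tensor is a symmetric bilinear form on
  them, hence a symmetric matrix with four \<open>3\<times>3\<close> blocks. The model is Einstein exactly when the
  mixed blocks vanish; an Einstein model is self-dual exactly when the anti-self-dual block is the
  one of a space of constant curvature, which is a multiple of \<open>diag(1, -1, -1)\<close>.

  Sufficiency. The skew operators \<open>I\<^sub>1, I\<^sub>2, I\<^sub>3\<close> given by the self-dual forms satisfy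
  \<open>\<langle>I\<^sub>i v, I\<^sub>j v\<rangle> = \<plusminus>\<delta>\<^sub>i\<^sub>j \<langle>v, v\<rangle>\<close>; they make the space a module over the split quaternions. For a
  self-dual Einstein model the Jacobi operator is a combination with constant coefficients of the
  maps \<open>y \<mapsto> \<langle>y, I\<^sub>i v\<rangle> I\<^sub>j v\<close>. In the moving basis \<open>v, I\<^sub>1 v, I\<^sub>2 v, I\<^sub>3 v\<close> its matrix is therefore
  \<open>\<langle>v, v\<rangle>\<close> times a fixed matrix: the Jordan form is constant on the unit vectors of either kind. For
  null \<open>v\<close> the same formula gives a square equal to zero, so all eigenvalues vanish.

  Necessity. Each of the Osserman conditions forces the traces of \<open>J(v)\<close> and \<open>J(v)\<^sup>2\<close> to vanish
  for null \<open>v\<close>: for unit vectors this is homogeneity and passage to the limit along a path of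
  non-null vectors, for null vectors it is homogeneity alone. The trace of \<open>J(v)\<close> is the Ricci form,
  so the model is Einstein. Null vectors are products \<open>(p, q) \<otimes> (a, b)\<close> of spinors, and along them the
  trace of \<open>J(v)\<^sup>2\<close> is, up to a constant, the product of a quartic form in \<open>(p, q)\<close> built from the
  self-dual block and a quartic form in \<open>(a, b)\<close> built from the anti-self-dual block. If the product
  vanishes identically, so does one of the factors, and then the corresponding block is a multiple
  of \<open>diag(1, -1, -1)\<close>. Which of the two it is decides the orientation; reversing one vector of the
  frame exchanges the blocks.
\<close>

section \<open>Traces and Jordan forms of complex matrices\<close>

definition mat_trace :: "'a::comm_ring_1 mat \<Rightarrow> 'a" where
  "mat_trace M = (\<Sum>i<dim_row M. M $$ (i, i))"

lemma mat_trace_mult: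
  assumes "M \<in> carrier_mat n m" "N \<in> carrier_mat m n"
  shows "mat_trace (M * N) = (\<Sum>i<n. \<Sum>k<m. M $$ (i, k) * N $$ (k, i))"
  using assms by (simp add: mat_trace_def scalar_prod_def atLeast0LessThan)

lemma mat_trace_mult_commute:
  assumes "M \<in> carrier_mat n m" "N \<in> carrier_mat m n"
  shows "mat_trace (M * N) = mat_trace (N * M)"
  unfolding mat_trace_mult[OF assms] mat_trace_mult[OF assms(2,1)]
  by (subst sum.swap) (simp add: mult.commute)

lemma mat_trace_similar:
  assumes "similar_mat M N"
  shows "mat_trace M = mat_trace N"
proof -
  obtain n P Q where w: "M \<in> carrier_mat n n" "N \<in> carrier_mat n n" "P \<in> carrier_mat n n"
      "Q \<in> carrier_mat n n" "Q * P = 1\<^sub>m n" "M = P * N * Q"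
    using assms unfolding similar_mat_def similar_mat_wit_def Let_def
    by (metis insert_subset)
  have "mat_trace M = mat_trace (P * (N * Q))" using w by simp
  also have "\<dots> = mat_trace (N * Q * P)" by (rule mat_trace_mult_commute[of _ n n]) (use w in auto)
  also have "N * Q * P = N" using w by simp
  finally show ?thesis .
qed

lemma proots_linear_factors: "proots (\<Prod>a\<leftarrow>as. [:- a, 1:]) = mset (as :: complex list)"
proof (induction as)
  case (Cons a as)
  have "(\<Prod>a\<leftarrow>as. [:- a, 1:]) \<noteq> 0" by (simp add: prod_list_zero_iff image_iff)
  then show ?case using Cons by (simp add: proots_mult del: mult_pCons_left)
qed simp

text \<open>Schur triangularization reduces both formulas to upper triangular matrices, whose square has the
  squared diagonal. They are what makes the traces of a Jacobi operator and of its square functions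
  of the eigenvalue multiset.\<close>

lemma mat_trace_eq_sum_proots:
  fixes M :: "complex mat"
  assumes "M \<in> carrier_mat n n"
  shows "mat_trace M = (\<Sum>a\<in>#proots (char_poly M). a)"
    and "mat_trace (M * M) = (\<Sum>a\<in>#proots (char_poly M). a\<^sup>2)"
proof -
  obtain as where as: "char_poly M = (\<Prod>a\<leftarrow>as. [:- a, 1:])"
    using char_poly_factorized[OF assms] by blast
  obtain B where B: "B \<in> carrier_mat n n" "upper_triangular B" "similar_mat M B"
    using schur_decomposition_exists[OF assms as] by blast
  have "char_poly M = (\<Prod>a\<leftarrow>diag_mat B. [:- a, 1:])"
    using char_poly_similar[OF B(3)] char_poly_upper_triangular[OF B(1,2)] by simp
  then have roots: "proots (char_poly M) = mset (diag_mat B)"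
    by (simp add: proots_linear_factors)
  have sum_diag: "(\<Sum>a\<in>#mset (diag_mat B). f a) = (\<Sum>i<n. f (B $$ (i, i)))" for f :: "complex \<Rightarrow> complex"
    using B(1) by (simp add: diag_mat_def sum_list_sum_nth atLeast0LessThan sum_mset_sum_list flip: mset_map)
  show "mat_trace M = (\<Sum>a\<in>#proots (char_poly M). a)"
    unfolding mat_trace_similar[OF B(3)] roots sum_diag[of "\<lambda>x. x"] using B(1) by (simp add: mat_trace_def)
  have sq: "similar_mat (M * M) (B * B)"
  proof -
    obtain P Q where w: "similar_mat_wit M B P Q" using B(3) by (auto simp: similar_mat_def)
    have "similar_mat_wit (M ^\<^sub>m 2) (B ^\<^sub>m 2) P Q" by (rule similar_mat_wit_pow[OF w])
    then show ?thesis using assms B(1) by (auto simp: similar_mat_def numeral_2_eq_2)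
  qed
  have "(\<Sum>k<n. B $$ (i, k) * B $$ (k, i)) = (B $$ (i, i))\<^sup>2" if "i < n" for i
  proof -
    have "B $$ (i, k) * B $$ (k, i) = 0" if "k < n" "k \<noteq> i" for k
      using that \<open>i < n\<close> B(1,2) unfolding upper_triangular_def by (metis carrier_matD(1) mult_eq_0_iff nat_neq_iff)
    then have "(\<Sum>k<n. B $$ (i, k) * B $$ (k, i)) = (\<Sum>k<n. if k = i then (B $$ (i, i))\<^sup>2 else 0)"
      by (intro sum.cong) (auto simp: power2_eq_square)
    then show ?thesis using that by simp
  qed
  then show "mat_trace (M * M) = (\<Sum>a\<in>#proots (char_poly M). a\<^sup>2)"
    unfolding mat_trace_similar[OF sq] roots sum_diag mat_trace_mult[OF B(1,1)] by simp
qed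

text \<open>An eigenvector for \<open>a\<close> is scaled by \<open>a\<^sup>2\<close> under the square, so every eigenvalue is zero; the degree
  gives the multiplicity.\<close>

lemma proots_char_poly_square_zero:
  fixes M :: "complex mat"
  assumes M: "M \<in> carrier_mat n n" and z: "M * M = 0\<^sub>m n n"
  shows "proots (char_poly M) = replicate_mset n 0"
proof -
  obtain as where as: "char_poly M = (\<Prod>a\<leftarrow>as. [:- a, 1:])" "length as = n"
    using char_poly_factorized[OF M] by blast
  have "a = 0" if "a \<in> set as" for a
  proof -
    have "poly (char_poly M) a = 0"
      using that by (auto simp: as(1) poly_prod_list prod_list_zero_iff)
    then obtain v where v: "eigenvector M v a"
      using eigenvalue_root_char_poly[OF M] by (auto simp: eigenvalue_def)
    then have v': "v \<in> carrier_vec n" "v \<noteq> 0\<^sub>v n" "M *\<^sub>v v = a \<cdot>\<^sub>v v"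
      using M by (auto simp: eigenvector_def)
    have "0\<^sub>v n = (M * M) *\<^sub>v v" unfolding z using v' by auto
    also have "\<dots> = M *\<^sub>v (M *\<^sub>v v)" using M v' by simp
    also have "\<dots> = a \<cdot>\<^sub>v (a \<cdot>\<^sub>v v)" using M v' by (simp add: mult_mat_vec)
    finally have *: "(a * a) \<cdot>\<^sub>v v = 0\<^sub>v n" by (simp add: smult_smult_assoc)
    obtain i where i: "i < n" "vec_index v i \<noteq> 0" using v'(1,2) by (metis eq_vecI carrier_vecD index_zero_vec)
    have "vec_index ((a * a) \<cdot>\<^sub>v v) i = 0" unfolding * using i by simp
    then show ?thesis using i v'(1) by simp
  qed
  then have "as = replicate n 0" using as(2) by (metis replicate_eqI)
  then show ?thesis by (simp only: as(1) proots_linear_factors mset_replicate)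
qed

lemma op_mat_compose:
  fixes e :: "4 \<Rightarrow> 'v::real_vector" and L :: "'v \<Rightarrow> 'v"
  assumes e: "is_basis e" and L: "linear L"
  shows "op_mat e L * op_mat e K = op_mat e (\<lambda>v. L (K v))"
proof (rule eq_matI)
  fix i j assume ij: "i < dim_row (op_mat e (\<lambda>v. L (K v)))" "j < dim_col (op_mat e (\<lambda>v. L (K v)))"
  let ?i = "of_nat (Suc i) :: 4" and ?w = "K (e (of_nat (Suc j)))"
  from ij have "(op_mat e L * op_mat e K) $$ (i, j) = (\<Sum>k = 0..<4. complex_of_real
      (coord e ?i (L (e (of_nat (Suc k)))) * coord e (of_nat (Suc k)) ?w))"
    by (simp add: op_mat_def scalar_prod_def del: of_nat_Suc)
  also have "\<dots> = complex_of_real (\<Sum>k\<in>UNIV. coord e ?i (L (e k)) * coord e k ?w)"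
    using sum_4_nat[of "\<lambda>k. coord e ?i (L (e k)) * coord e k ?w"] by (simp only: of_real_sum[symmetric])
  also have "(\<Sum>k\<in>UNIV. coord e ?i (L (e k)) * coord e k ?w) = coord e ?i (L (\<Sum>k\<in>UNIV. coord e k ?w *\<^sub>R e k))"
    using linear_coord[OF e] L by (simp add: linear_sum linear_cmul mult.commute)
  also have "\<dots> = coord e ?i (L ?w)" by (simp only: coord_expand[OF e])
  finally show "(op_mat e L * op_mat e K) $$ (i, j) = op_mat e (\<lambda>v. L (K v)) $$ (i, j)"
    using ij by (simp add: op_mat_def del: of_nat_Suc)
qed (simp_all add: op_mat_def)

lemma complex_eigenvalues_square_zero:
  fixes e :: "4 \<Rightarrow> 'v::real_vector" and L :: "'v \<Rightarrow> 'v"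
  assumes e: "is_basis e" and L: "linear L" and z: "\<And>v. L (L v) = 0"
  shows "complex_eigenvalues L = replicate_mset 4 0"
proof -
  have "op_mat e L * op_mat e L = 0\<^sub>m 4 4"
    unfolding op_mat_compose[OF e L] z using linear_0[OF linear_coord[OF e]]
    by (intro eq_matI) (simp_all add: op_mat_def)
  then show ?thesis
    unfolding complex_eigenvalues_eq[OF L e] by (intro proots_char_poly_square_zero) (simp add: op_mat_def)
qed

lemma complex_jordan_nf_exists:
  assumes "(M :: complex mat) \<in> carrier_mat n n"
  shows "\<exists>n_as. jordan_nf M n_as"
  using char_poly_factorized[OF assms] jordan_nf_exists[OF assms] by blast

lemma jordan_osserman_imp_osserman:
  assumes "jordan_osserman_on S ip A"
  shows "osserman_on S ip A"
proof -
  obtain n_as where "\<forall>v\<in>S. has_jordan_form (jacobi_op ip A v) n_as"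
    using assms by (auto simp: jordan_osserman_on_def)
  then have "\<forall>v\<in>S. complex_eigenvalues (jacobi_op ip A v) = proots (\<Prod>(n, a)\<leftarrow>n_as. [:- a, 1:] ^ n)"
    unfolding has_jordan_form_def complex_eigenvalues_def using jordan_nf_char_poly by metis
  then show ?thesis by (auto simp: osserman_on_def)
qed

section \<open>Determinants and wedge products in dimension four\<close>

text \<open>Determinants and wedge products are sums over the 24 permutations; here they are written out once
  and for all.\<close>

lemma sum_permutations_4:
  fixes g :: "4 \<Rightarrow> 4 \<Rightarrow> 4 \<Rightarrow> 4 \<Rightarrow> real"
  shows "(\<Sum>p | p permutes (UNIV :: 4 set). of_int (sign p) * g (p 1) (p 2) (p 3) (p 4)) =
    g 1 2 3 4 - g 1 2 4 3 - g 1 3 2 4 + g 1 3 4 2 + g 1 4 2 3 - g 1 4 3 2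
    - g 2 1 3 4 + g 2 1 4 3 + g 2 3 1 4 - g 2 3 4 1 - g 2 4 1 3 + g 2 4 3 1
    + g 3 1 2 4 - g 3 1 4 2 - g 3 2 1 4 + g 3 2 4 1 + g 3 4 1 2 - g 3 4 2 1
    - g 4 1 2 3 + g 4 1 3 2 + g 4 2 1 3 - g 4 2 3 1 - g 4 3 1 2 + g 4 3 2 1"
proof -
  have f234: "finite {2::4, 3, 4}" "1 \<notin> {2::4, 3, 4}" by auto
  have f34: "finite {3::4, 4}" "2 \<notin> {3::4, 4}" by auto
  have f4: "finite {4::4}" "3 \<notin> {4::4}" by auto
  show ?thesis
    unfolding UNIV_4
    unfolding sum_over_permutations_insert[OF f234]
    unfolding sum_over_permutations_insert[OF f34]
    unfolding sum_over_permutations_insert[OF f4]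
    unfolding permutes_sing
    by (simp add: sign_swap_id permutation_swap_id permutation_compose sign_compose sign_id swap_id_eq)
qed

lemma det_4:
  fixes M :: "real^4^4"
  shows "det M = (M$1$1 * M$2$2 - M$2$1 * M$1$2) * (M$3$3 * M$4$4 - M$4$3 * M$3$4)
    - (M$1$1 * M$3$2 - M$3$1 * M$1$2) * (M$2$3 * M$4$4 - M$4$3 * M$2$4)
    + (M$1$1 * M$4$2 - M$4$1 * M$1$2) * (M$2$3 * M$3$4 - M$3$3 * M$2$4)
    + (M$2$1 * M$3$2 - M$3$1 * M$2$2) * (M$1$3 * M$4$4 - M$4$3 * M$1$4)
    - (M$2$1 * M$4$2 - M$4$1 * M$2$2) * (M$1$3 * M$3$4 - M$3$3 * M$1$4)
    + (M$3$1 * M$4$2 - M$4$1 * M$3$2) * (M$1$3 * M$2$4 - M$2$3 * M$1$4)"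
proof -
  have "prod (\<lambda>i. M $ i $ p i) UNIV = M$1$p 1 * M$2$p 2 * M$3$p 3 * M$4$p 4" for p
    unfolding UNIV_4 by (simp add: mult.assoc)
  then show ?thesis
    unfolding Determinants.det_def
    by (simp add: sum_permutations_4[of "\<lambda>i j k l. M$1$i * M$2$j * M$3$k * M$4$l"]) (simp add: algebra_simps)
qed

lemma wedge_4:
  assumes "\<And>x y. \<phi> x y = - \<phi> y x" "\<And>x y. \<psi> x y = - \<psi> y x"
  shows "wedge \<phi> \<psi> x = \<phi> (x 1) (x 2) * \<psi> (x 3) (x 4) - \<phi> (x 1) (x 3) * \<psi> (x 2) (x 4)
    + \<phi> (x 1) (x 4) * \<psi> (x 2) (x 3) + \<phi> (x 2) (x 3) * \<psi> (x 1) (x 4)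
    - \<phi> (x 2) (x 4) * \<psi> (x 1) (x 3) + \<phi> (x 3) (x 4) * \<psi> (x 1) (x 2)"
proof -
  have \<phi>: "\<phi> (x 2) (x 1) = - \<phi> (x 1) (x 2)" "\<phi> (x 3) (x 1) = - \<phi> (x 1) (x 3)"
    "\<phi> (x 4) (x 1) = - \<phi> (x 1) (x 4)" "\<phi> (x 3) (x 2) = - \<phi> (x 2) (x 3)"
    "\<phi> (x 4) (x 2) = - \<phi> (x 2) (x 4)" "\<phi> (x 4) (x 3) = - \<phi> (x 3) (x 4)"
    by (rule assms(1))+
  have \<psi>: "\<psi> (x 2) (x 1) = - \<psi> (x 1) (x 2)" "\<psi> (x 3) (x 1) = - \<psi> (x 1) (x 3)"
    "\<psi> (x 4) (x 1) = - \<psi> (x 1) (x 4)" "\<psi> (x 3) (x 2) = - \<psi> (x 2) (x 3)"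
    "\<psi> (x 4) (x 2) = - \<psi> (x 2) (x 4)" "\<psi> (x 4) (x 3) = - \<psi> (x 3) (x 4)"
    by (rule assms(2))+
  show ?thesis
    unfolding wedge_def mult.assoc[of "of_int _"]
      sum_permutations_4[of "\<lambda>i j k l. \<phi> (x i) (x j) * \<psi> (x k) (x l)"]
    by (simp add: \<phi> \<psi>)
qed

text \<open>A two-form in coordinates is a combination of the \<open>2\<times>2\<close> minors of its two arguments, and the wedge
  product of two such forms is the signed sum over the (2,2)-shuffles.\<close>

definition minor :: "4 \<Rightarrow> 4 \<Rightarrow> (4 \<Rightarrow> real) \<Rightarrow> (4 \<Rightarrow> real) \<Rightarrow> real" where
  "minor i j x y = x i * y j - x j * y i"

definition combine_minors :: "(4 \<Rightarrow> 4 \<Rightarrow> real) \<Rightarrow> (4 \<Rightarrow> real) \<Rightarrow> (4 \<Rightarrow> real) \<Rightarrow> real" where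
  "combine_minors p x y = p 1 2 * minor 1 2 x y + p 1 3 * minor 1 3 x y + p 1 4 * minor 1 4 x y
     + p 2 3 * minor 2 3 x y + p 2 4 * minor 2 4 x y + p 3 4 * minor 3 4 x y"

definition shuffle_product where
  "shuffle_product f g x y z w = f x y * g z w - f x z * g y w + f x w * g y z
     + f y z * g x w - f y w * g x z + (f z w * g x y :: real)"

text \<open>By Laplace expansion, the shuffle product of two minors is the \<open>4\<times>4\<close> determinant up to sign if
  their index pairs are complementary, and it vanishes if they share an index because the
  determinant then has a repeated row.\<close>

lemma shuffle_product_minor:
  defines "D \<equiv> shuffle_product (minor 1 2) (minor 3 4)"
  shows "shuffle_product (minor 1 2) (combine_minors q) x y z w = q 3 4 * D x y z w"
    and "shuffle_product (minor 1 3) (combine_minors q) x y z w = - q 2 4 * D x y z w"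
    and "shuffle_product (minor 1 4) (combine_minors q) x y z w = q 2 3 * D x y z w"
    and "shuffle_product (minor 2 3) (combine_minors q) x y z w = q 1 4 * D x y z w"
    and "shuffle_product (minor 2 4) (combine_minors q) x y z w = - q 1 3 * D x y z w"
    and "shuffle_product (minor 3 4) (combine_minors q) x y z w = q 1 2 * D x y z w"
  by (simp_all add: D_def shuffle_product_def combine_minors_def minor_def algebra_simps)

lemma shuffle_product_combine_minors:
  "shuffle_product (combine_minors p) (combine_minors q) x y z w =
    (p 1 2 * q 3 4 - p 1 3 * q 2 4 + p 1 4 * q 2 3 + p 2 3 * q 1 4 - p 2 4 * q 1 3 + p 3 4 * q 1 2)
    * shuffle_product (minor 1 2) (minor 3 4) x y z w"
proof -
  have "shuffle_product (combine_minors p) g x y z w =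
      p 1 2 * shuffle_product (minor 1 2) g x y z w + p 1 3 * shuffle_product (minor 1 3) g x y z w
    + p 1 4 * shuffle_product (minor 1 4) g x y z w + p 2 3 * shuffle_product (minor 2 3) g x y z w
    + p 2 4 * shuffle_product (minor 2 4) g x y z w + p 3 4 * shuffle_product (minor 3 4) g x y z w" for g
    by (simp add: shuffle_product_def combine_minors_def algebra_simps)
  then show ?thesis by (simp only: shuffle_product_minor) (simp add: algebra_simps)
qed

lemma det_4_shuffle:
  "det (\<chi> i j. M j i) = shuffle_product (minor 1 2) (minor 3 4) (M 1) (M 2) (M 3) (M 4)"
  unfolding det_4 by (simp add: shuffle_product_def minor_def algebra_simps)

lemma det_coord_change:
  assumes "is_basis e" "is_basis f"
  shows "det (\<chi> i j. coord e i (x j)) = det (\<chi> i j. coord e i (f j)) * det (\<chi> i j. coord f i (x j))"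
proof -
  have "(\<chi> i j. coord e i (x j)) = (\<chi> i j. coord e i (f j)) ** (\<chi> i j. coord f i (x j))"
    by (simp add: matrix_matrix_mult_def coord_change[OF assms])
  then show ?thesis by (simp add: Determinants.det_mul)
qed

lemma det_coord_inverse:
  assumes "is_basis e" "is_basis f"
  shows "det (\<chi> i j. coord e i (f j)) * det (\<chi> i j. coord f i (e j)) = 1"
proof -
  have "det (\<chi> i j. coord e i (e j)) = 1"
  proof -
    have "(\<chi> i j. coord e i (e j)) = (Finite_Cartesian_Product.mat 1 :: real^4^4)"
      by (simp add: Finite_Cartesian_Product.vec_eq_iff Finite_Cartesian_Product.mat_def coord_basis[OF assms(1)])
    then show ?thesis by simp
  qed
  then show ?thesis using det_coord_change[OF assms, of e] by simp
qed

lemma det_coord_same_orientation_pos: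
  assumes "Or \<in> orientations" "e \<in> Or" "f \<in> Or"
  shows "det (\<chi> i j. coord e i (f j)) > 0"
proof -
  obtain b where b: "is_basis b" "Or = same_orientation `` {b}"
    using assms(1) by (auto simp: orientations_def quotient_def)
  then have e: "is_basis e" "det (\<chi> i j. coord b i (e j)) > 0"
    and f: "is_basis f" "det (\<chi> i j. coord b i (f j)) > 0"
    using assms(2,3) by (auto simp: same_orientation_def)
  have "det (\<chi> i j. coord b i (e j)) * det (\<chi> i j. coord e i (f j)) > 0"
    using det_coord_change[OF b(1) e(1), of f] f(2) by simp
  then show "det (\<chi> i j. coord e i (f j)) > 0" using e(2) by (simp add: zero_less_mult_iff)
qed

section \<open>Models in an orthonormal frame\<close>

locale orthonormal_model =
  fixes ip :: "'v::real_vector \<Rightarrow> 'v \<Rightarrow> real"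
    and A :: "'v \<Rightarrow> 'v \<Rightarrow> 'v \<Rightarrow> 'v \<Rightarrow> real"
    and e :: "4 \<Rightarrow> 'v"
  assumes model: "neutral_model ip A" and onb: "orthonormal_basis ip e"
begin

abbreviation co :: "4 \<Rightarrow> 'v \<Rightarrow> real" where "co \<equiv> coord e"

lemma basis: "is_basis e"
  using onb by (simp add: orthonormal_basis_def)

lemma neutral: "neutral_inner_product ip"
  using model by (simp add: neutral_model_def)

lemma curvature: "curvature_tensor A"
  using model by (simp add: neutral_model_def)

lemma ip_bilinear: "bilinear ip" and ip_commute: "ip x y = ip y x"
  and ip_nondegenerate: "(\<And>y. ip x y = 0) \<Longrightarrow> x = 0"
  using neutral by (auto simp: neutral_inner_product_def)

lemma ip_basis_pair:
  "ip (e i) (e j) = (if i = j then if i = 1 \<or> i = 2 then -1 else 1 else 0)"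
  using onb exhaust_4[of i] by (auto simp: orthonormal_basis_def)

lemma ip_linear: "linear (ip x)" "linear (\<lambda>x. ip x y)"
  using ip_bilinear by (auto simp: bilinear_def)

lemmas ip_simps = linear_add[OF ip_linear(1)] linear_add[OF ip_linear(2)]
  linear_cmul[OF ip_linear(1)] linear_cmul[OF ip_linear(2)] linear_0[OF ip_linear(1)]
  linear_0[OF ip_linear(2)] linear_diff[OF ip_linear(1)] linear_diff[OF ip_linear(2)]
  linear_neg[OF ip_linear(1)] linear_neg[OF ip_linear(2)]

lemma co_basis [simp]: "co i (e j) = (if i = j then 1 else 0)"
  by (rule coord_basis[OF basis])

lemma co_linear [simp]: "co i (x + y) = co i x + co i y" "co i (a *\<^sub>R x) = a * co i x"
  "co i (- x) = - co i x" "co i (x - y) = co i x - co i y" "co i 0 = 0"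
  using linear_coord[OF basis, of i]
  by (simp_all add: linear_add linear_cmul linear_neg linear_diff linear_0)

lemma expand: "x = (\<Sum>i\<in>UNIV. co i x *\<^sub>R e i)"
  by (simp add: coord_expand[OF basis])

lemma bilinear_expand:
  assumes "bilinear T"
  shows "T x y = (\<Sum>i\<in>UNIV. \<Sum>j\<in>UNIV. co i x * co j y * T (e i) (e j))"
proof -
  have l: "linear (T x)" "linear (\<lambda>x. T x y)" for x y using assms by (auto simp: bilinear_def)
  have "T x y = (\<Sum>i\<in>UNIV. co i x * T (e i) y)"
    by (subst expand[of x]) (simp add: linear_sum[OF l(2)] linear_cmul[OF l(2)])
  also have "\<dots> = (\<Sum>i\<in>UNIV. co i x * (\<Sum>j\<in>UNIV. co j y * T (e i) (e j)))"
    by (subst expand[of y]) (simp add: linear_sum[OF l(1)] linear_cmul[OF l(1)])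
  finally show ?thesis by (simp add: sum_distrib_left mult.assoc)
qed

lemma ip_coords: "ip x y = - co 1 x * co 1 y - co 2 x * co 2 y + co 3 x * co 3 y + co 4 x * co 4 y"
  by (subst bilinear_expand[OF ip_bilinear]) (simp add: sum_4 ip_basis_pair)

definition \<eta> :: "4 \<Rightarrow> real" where "\<eta> i = (if i = 1 \<or> i = 2 then -1 else 1)"

lemma \<eta>_simps [simp]: "\<eta> 1 = -1" "\<eta> 2 = -1" "\<eta> 3 = 1" "\<eta> 4 = 1"
  by (simp_all add: \<eta>_def)

lemma ip_basis_right: "ip x (e i) = \<eta> i * co i x"
  using exhaust_4[of i] by (auto simp: ip_coords)

lemma contract_orthonormal:
  assumes "bilinear T"
  shows "contract ip T = (\<Sum>i\<in>UNIV. \<eta> i * T (e i) (e i))"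
proof -
  have G: "gram ip e = (\<chi> i j. if i = j then \<eta> i else 0)"
    by (simp add: gram_def ip_basis_pair \<eta>_def Finite_Cartesian_Product.vec_eq_iff)
  have "gram ip e ** gram ip e = mat 1"
    by (simp add: G matrix_matrix_mult_def Finite_Cartesian_Product.vec_eq_iff
        Finite_Cartesian_Product.mat_def forall_4 sum_4)
  then have "matrix_inv (gram ip e) = gram ip e" by (intro matrix_inv_eqI)
  then show ?thesis
    unfolding contract_eq[OF neutral assms basis] contract_wrt_def
    by (simp add: G sum_4)
qed

lemma A_linear:
  "linear (\<lambda>x. A x y z v)" "linear (\<lambda>y. A x y z v)"
  "linear (\<lambda>z. A x y z v)" "linear (\<lambda>v. A x y z v)"
proof -
  note c = curvature[unfolded curvature_tensor_def]
  show "linear (\<lambda>x. A x y z v)" by (rule c[THEN conjunct1, rule_format])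
  show "linear (\<lambda>y. A x y z v)" by (rule c[THEN conjunct2, THEN conjunct1, rule_format])
  show "linear (\<lambda>z. A x y z v)" by (rule c[THEN conjunct2, THEN conjunct2, THEN conjunct1, rule_format])
  show "linear (\<lambda>v. A x y z v)"
    by (rule c[THEN conjunct2, THEN conjunct2, THEN conjunct2, THEN conjunct1, rule_format])
qed

lemma A_swap12: "A x y z v = - A y x z v" and A_pairs: "A x y z v = A z v x y"
  and bianchi: "A x y z v + A y z x v + A z x y v = 0"
  using curvature unfolding curvature_tensor_def by blast+

lemma A_swap34: "A x y z v = - A x y v z"
proof -
  have "A x y z v = A z v x y" by (rule A_pairs)
  also have "\<dots> = - A v z x y" by (rule A_swap12)
  also have "A v z x y = A x y v z" by (rule A_pairs)
  finally show ?thesis .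
qed

lemma A_diag [simp]: "A x x z v = 0" "A x y z z = 0"
  using A_swap12[of x x z v] A_swap34[of x y z z] by simp_all

lemmas A_add = A_linear[THEN linear_add]
lemmas A_cmul = A_linear[THEN linear_cmul]

text \<open>Rewrite rules that bring the components of the curvature tensor into a normal form: within a pair
  the indices increase, and the pairs are in lexicographic order. Together with the two consequences
  of the first Bianchi identity they leave the 20 independent components.\<close>

lemma A_symmetry_normal:
  shows "A (e 2) (e 1) z v = - A (e 1) (e 2) z v" "A (e 3) (e 1) z v = - A (e 1) (e 3) z v"
    "A (e 4) (e 1) z v = - A (e 1) (e 4) z v" "A (e 3) (e 2) z v = - A (e 2) (e 3) z v"
    "A (e 4) (e 2) z v = - A (e 2) (e 4) z v" "A (e 4) (e 3) z v = - A (e 3) (e 4) z v"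
    "A x y (e 2) (e 1) = - A x y (e 1) (e 2)" "A x y (e 3) (e 1) = - A x y (e 1) (e 3)"
    "A x y (e 4) (e 1) = - A x y (e 1) (e 4)" "A x y (e 3) (e 2) = - A x y (e 2) (e 3)"
    "A x y (e 4) (e 2) = - A x y (e 2) (e 4)" "A x y (e 4) (e 3) = - A x y (e 3) (e 4)"
    "A (e 1) (e 3) (e 1) (e 2) = A (e 1) (e 2) (e 1) (e 3)"
    "A (e 1) (e 4) (e 1) (e 2) = A (e 1) (e 2) (e 1) (e 4)"
    "A (e 2) (e 3) (e 1) (e 2) = A (e 1) (e 2) (e 2) (e 3)"
    "A (e 2) (e 4) (e 1) (e 2) = A (e 1) (e 2) (e 2) (e 4)"
    "A (e 3) (e 4) (e 1) (e 2) = A (e 1) (e 2) (e 3) (e 4)"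
    "A (e 1) (e 4) (e 1) (e 3) = A (e 1) (e 3) (e 1) (e 4)"
    "A (e 2) (e 3) (e 1) (e 3) = A (e 1) (e 3) (e 2) (e 3)"
    "A (e 2) (e 4) (e 1) (e 3) = A (e 1) (e 3) (e 2) (e 4)"
    "A (e 3) (e 4) (e 1) (e 3) = A (e 1) (e 3) (e 3) (e 4)"
    "A (e 2) (e 4) (e 1) (e 4) = A (e 1) (e 4) (e 2) (e 4)"
    "A (e 3) (e 4) (e 1) (e 4) = A (e 1) (e 4) (e 3) (e 4)"
    "A (e 2) (e 4) (e 2) (e 3) = A (e 2) (e 3) (e 2) (e 4)"
    "A (e 3) (e 4) (e 2) (e 3) = A (e 2) (e 3) (e 3) (e 4)"
    "A (e 3) (e 4) (e 2) (e 4) = A (e 2) (e 4) (e 3) (e 4)"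
  by (rule A_swap12 A_swap34 A_pairs)+

lemma A_bianchi_normal:
  "A (e 2) (e 3) (e 1) (e 4) = A (e 1) (e 3) (e 2) (e 4) - A (e 1) (e 2) (e 3) (e 4)"
  "A (e 1) (e 4) (e 2) (e 3) = A (e 1) (e 3) (e 2) (e 4) - A (e 1) (e 2) (e 3) (e 4)"
  using bianchi[of "e 1" "e 2" "e 3" "e 4"] A_swap12[of "e 3" "e 1"]
    A_pairs[of "e 2" "e 3" "e 1" "e 4"] by simp_all

lemmas A_normal = A_symmetry_normal A_bianchi_normal

lemma bilinear_A:
  "bilinear (\<lambda>x y. A x y z v)" "bilinear (\<lambda>z v. A x y z v)" "bilinear (\<lambda>x v. A x y z v)"
  using A_linear by (simp_all add: bilinear_def)

lemma ricci_orthonormal: "ricci ip A x y = (\<Sum>i\<in>UNIV. \<eta> i * A (e i) x y (e i))"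
  unfolding ricci_def by (rule contract_orthonormal[OF bilinear_A(3)])

lemma bilinear_ricci: "bilinear (ricci ip A)"
  unfolding ricci_orthonormal[abs_def] bilinear_def
  by (auto intro!: linearI simp: A_add A_cmul sum.distrib sum_distrib_left algebra_simps)

lemma scalar_orthonormal: "scalar_curvature ip A = (\<Sum>i\<in>UNIV. \<eta> i * ricci ip A (e i) (e i))"
  unfolding scalar_curvature_def by (rule contract_orthonormal[OF bilinear_ricci])

lemma jacobi_ip: "ip (jacobi_op ip A x y) z = A y x x z"
proof -
  define w where "w = (\<Sum>i\<in>UNIV. (\<eta> i * A y x x (e i)) *\<^sub>R e i)"
  have w: "ip w z = A y x x z" for z
  proof -
    have "ip (e i) z = \<eta> i * co i z" for i using ip_basis_right[of z i] ip_commute[of z] by simp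
    then have "ip w z = (\<Sum>i\<in>UNIV. \<eta> i * \<eta> i * (co i z * A y x x (e i)))"
      by (simp add: w_def linear_sum[OF ip_linear(2)] ip_simps mult_ac)
    also have "\<dots> = (\<Sum>i\<in>UNIV. co i z * A y x x (e i))"
      by (intro sum.cong) (auto simp: \<eta>_def)
    also have "\<dots> = A y x x (\<Sum>i\<in>UNIV. co i z *\<^sub>R e i)"
      by (simp add: linear_sum[OF A_linear(4)] A_cmul)
    also have "\<dots> = A y x x z" using expand[of z] by simp
    finally show ?thesis .
  qed
  have "(THE w. \<forall>z. ip w z = A y x x z) = w"
  proof (rule the_equality)
    fix u assume "\<forall>z. ip u z = A y x x z"
    then have "u - w = 0" by (intro ip_nondegenerate) (simp add: ip_simps w)
    then show "u = w" by simp
  qed (simp add: w)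
  then show ?thesis by (simp add: jacobi_op_def w)
qed

lemma ip_eqI:
  assumes "\<And>z. ip x z = ip y z" shows "x = y"
proof -
  have "x - y = 0" by (rule ip_nondegenerate) (simp add: ip_simps assms)
  then show ?thesis by simp
qed

lemma linear_jacobi: "linear (jacobi_op ip A x)"
proof (rule linearI)
  show "jacobi_op ip A x (y + z) = jacobi_op ip A x y + jacobi_op ip A x z" for y z
    by (rule ip_eqI) (simp only: jacobi_ip ip_simps A_add)
  show "jacobi_op ip A x (a *\<^sub>R y) = a *\<^sub>R jacobi_op ip A x y" for a y
    by (rule ip_eqI) (simp only: jacobi_ip ip_simps A_cmul)
qed

text \<open>Orthogonality and non-null members give independence; for an indefinite form the second
  condition does not follow from the vectors being non-zero.\<close>

lemma orthogonal_is_basis: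
  assumes orth: "\<And>i j. i \<noteq> j \<Longrightarrow> ip (f i) (f j) = 0" and nz: "\<And>i. ip (f i) (f i) \<noteq> 0"
    and span: "\<And>y. \<exists>a. y = (\<Sum>i\<in>UNIV. a i *\<^sub>R f i)"
  shows "is_basis f"
proof -
  have inj: "inj f" by (rule injI) (metis orth nz)
  have "independent (range f)"
  proof (rule real_vector.independent_if_scalars_zero)
    fix g x assume 0: "(\<Sum>x\<in>range f. g x *\<^sub>R x) = 0" and "x \<in> range f"
    then obtain j where x: "x = f j" by blast
    have "0 = ip (\<Sum>i\<in>UNIV. g (f i) *\<^sub>R f i) (f j)"
      using 0 by (simp add: sum.reindex[OF inj] ip_simps)
    also have "\<dots> = (\<Sum>i\<in>UNIV. if i = j then g (f j) * ip (f j) (f j) else 0)"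
      unfolding linear_sum[OF ip_linear(2)] by (intro sum.cong) (auto simp: ip_simps orth)
    finally show "g x = 0" using nz[of j] x by simp
  qed simp
  moreover have "span (range f) = UNIV"
  proof (intro equalityI subset_UNIV subsetI)
    fix y obtain a where "y = (\<Sum>i\<in>UNIV. a i *\<^sub>R f i)" using span by blast
    then show "y \<in> span (range f)" by (simp add: span_sum span_scale span_base)
  qed
  ultimately show ?thesis using inj by (simp add: is_basis_def)
qed

end

section \<open>Orthonormal frames and orientations\<close>

context orthonormal_model
begin

text \<open>Negating the last vector of the frame passes to the opposite orientation.\<close>

abbreviation flip :: "4 \<Rightarrow> 'v" where "flip \<equiv> e(4 := - e 4)"

lemma orthonormal_flip: "orthonormal_basis ip flip"
proof -
  have "is_basis flip"
  proof (rule orthogonal_is_basis)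
    show "ip (flip i) (flip j) = 0" if "i \<noteq> j" for i j
      using that by (auto simp: ip_simps ip_basis_pair)
    show "ip (flip i) (flip i) \<noteq> 0" for i
      by (auto simp: ip_simps ip_basis_pair)
    fix y
    define a where "a = (\<lambda>i. if i = 4 then - co 4 y else co i y)"
    have "y = (\<Sum>i\<in>UNIV. co i y *\<^sub>R e i)" by (rule expand)
    also have "\<dots> = (\<Sum>i\<in>UNIV. a i *\<^sub>R flip i)"
      by (intro sum.cong) (auto simp: a_def)
    finally show "\<exists>a. y = (\<Sum>i\<in>UNIV. a i *\<^sub>R flip i)" by (rule exI[of _ a])
  qed
  then show ?thesis by (auto simp: orthonormal_basis_def ip_simps ip_basis_pair)
qed

lemma det_coord_flip:
  assumes "is_basis b"
  shows "det (\<chi> i j. coord b i (flip j)) = - det (\<chi> i j. coord b i (e j))"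
  using linear_neg[OF linear_coord[OF assms]] by (simp add: det_4 algebra_simps)

lemma orthonormal_basis_in_orientation:
  assumes "Or \<in> orientations"
  shows "\<exists>f\<in>Or. orthonormal_basis ip f"
proof -
  obtain b where b: "is_basis b" "Or = same_orientation `` {b}"
    using assms by (auto simp: orientations_def quotient_def)
  have mem: "f \<in> Or \<longleftrightarrow> is_basis f \<and> det (\<chi> i j. coord b i (f j)) > 0" for f
    using b by (auto simp: same_orientation_def)
  have nz: "det (\<chi> i j. coord b i (e j)) \<noteq> 0" using det_coord_inverse[OF b(1) basis] by auto
  show ?thesis
  proof (cases "det (\<chi> i j. coord b i (e j)) > 0")
    case True
    then show ?thesis using onb basis mem by blast
  next
    case False
    then have "det (\<chi> i j. coord b i (flip j)) > 0"
      unfolding det_coord_flip[OF b(1)] using nz by simp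
    then have "flip \<in> Or"
      using mem[of flip] orthonormal_flip unfolding orthonormal_basis_def by blast
    then show ?thesis using orthonormal_flip by blast
  qed
qed

lemma orientation_of_basis: "same_orientation `` {e} \<in> orientations" "e \<in> same_orientation `` {e}"
proof -
  show "same_orientation `` {e} \<in> orientations"
    using basis by (auto simp: orientations_def quotient_def)
  have "(\<chi> i j. co i (e j)) = (Finite_Cartesian_Product.mat 1 :: real^4^4)"
    by (simp add: Finite_Cartesian_Product.vec_eq_iff Finite_Cartesian_Product.mat_def)
  then show "e \<in> same_orientation `` {e}" using basis by (simp add: same_orientation_def)
qed

text \<open>The change of basis \<open>P\<close> satisfies \<open>P\<^sup>T G P = G\<close> for the Gram matrix \<open>G\<close>, so its determinant is 1 or
  -1, and the common orientation excludes -1. This is the consistency that the definition of the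
  Hodge operator needs: it refers to all oriented orthonormal frames at once.\<close>

lemma vol_form_orthonormal:
  assumes "Or \<in> orientations" "e \<in> Or" "f \<in> Or" "orthonormal_basis ip f"
  shows "vol_form f x = vol_form e x"
proof -
  let ?P = "\<chi> i j. co i (f j)"
  interpret f: orthonormal_model ip A f
    using model assms(4) by unfold_locales
  have gram: "gram ip f = gram ip e"
    by (simp add: gram_def ip_basis_pair f.ip_basis_pair)
  have "det (gram ip e) = det (transpose ?P ** gram ip e ** ?P)"
    using bilinear_change[OF basis ip_bilinear, of f] gram by (simp add: gram_def)
  also have "\<dots> = det ?P * det (gram ip e) * det ?P"
    by (simp add: Determinants.det_mul Determinants.det_transpose)
  finally have 1: "det (gram ip e) * (det ?P * det ?P - 1) = 0" by (simp add: algebra_simps)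
  have "det (gram ip e) = 1"
    by (simp add: det_4 gram_def ip_basis_pair)
  with 1 have "det ?P * det ?P = 1" by simp
  then have "(det ?P - 1) * (det ?P + 1) = 0" by (simp add: algebra_simps)
  moreover have "det ?P > 0" by (rule det_coord_same_orientation_pos[OF assms(1-3)])
  ultimately have "det ?P = 1" by auto
  then show ?thesis
    using det_coord_change[OF basis f.basis, of x] by (simp add: vol_form_def)
qed

end

section \<open>The curvature tensor as a form on self-dual and anti-self-dual two-forms\<close>

context orthonormal_model
begin

text \<open>For \<open>s = 1\<close> these are the self-dual forms \<open>e\<^sub>1\<^sub>2 + e\<^sub>3\<^sub>4\<close>, \<open>e\<^sub>1\<^sub>3 + e\<^sub>2\<^sub>4\<close>, \<open>e\<^sub>1\<^sub>4 - e\<^sub>2\<^sub>3\<close>, for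
  \<open>s = -1\<close> the anti-self-dual forms with the opposite middle signs. Keeping the sign as a parameter
  treats both summands at once.\<close>

definition form :: "real \<Rightarrow> 3 \<Rightarrow> 'v \<Rightarrow> 'v \<Rightarrow> real" where
  "form s i x y = (let m = (\<lambda>j k. co j x * co k y - co k x * co j y) in
     if i = 1 then m 1 2 + s * m 3 4 else if i = 2 then m 1 3 + s * m 2 4 else m 1 4 - s * m 2 3)"

text \<open>Twice the coefficient of the form with the same parameters.\<close>

definition component :: "real \<Rightarrow> 3 \<Rightarrow> ('v \<Rightarrow> 'v \<Rightarrow> real) \<Rightarrow> real" where
  "component s i \<phi> = (if i = 1 then \<phi> (e 1) (e 2) + s * \<phi> (e 3) (e 4)
     else if i = 2 then \<phi> (e 1) (e 3) + s * \<phi> (e 2) (e 4) else \<phi> (e 1) (e 4) - s * \<phi> (e 2) (e 3))"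

text \<open>The matrix of the curvature tensor as a bilinear form on two-forms, in four \<open>3\<times>3\<close> blocks.\<close>

definition block :: "real \<Rightarrow> real \<Rightarrow> 3 \<Rightarrow> 3 \<Rightarrow> real" where
  "block s t i j = component s i (\<lambda>x y. component t j (A x y))"

text \<open>The signs of the squared lengths of the three forms in either family.\<close>

definition \<epsilon> :: "3 \<Rightarrow> real" where "\<epsilon> i = (if i = 1 then 1 else -1)"

lemma two_form_coords:
  assumes "\<phi> \<in> two_forms"
  shows "\<phi> x y = \<phi> (e 1) (e 2) * (co 1 x * co 2 y - co 2 x * co 1 y)
    + \<phi> (e 1) (e 3) * (co 1 x * co 3 y - co 3 x * co 1 y)
    + \<phi> (e 1) (e 4) * (co 1 x * co 4 y - co 4 x * co 1 y)
    + \<phi> (e 2) (e 3) * (co 2 x * co 3 y - co 3 x * co 2 y)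
    + \<phi> (e 2) (e 4) * (co 2 x * co 4 y - co 4 x * co 2 y)
    + \<phi> (e 3) (e 4) * (co 3 x * co 4 y - co 4 x * co 3 y)"
proof -
  have b: "bilinear \<phi>" and a: "\<And>x y. \<phi> x y = - \<phi> y x"
    using assms unfolding two_forms_def by blast+
  have d: "\<phi> x x = 0" for x using a[of x x] by linarith
  have n: "\<phi> (e 2) (e 1) = - \<phi> (e 1) (e 2)" "\<phi> (e 3) (e 1) = - \<phi> (e 1) (e 3)"
    "\<phi> (e 4) (e 1) = - \<phi> (e 1) (e 4)" "\<phi> (e 3) (e 2) = - \<phi> (e 2) (e 3)"
    "\<phi> (e 4) (e 2) = - \<phi> (e 2) (e 4)" "\<phi> (e 4) (e 3) = - \<phi> (e 3) (e 4)"
    by (rule a)+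
  show ?thesis
    by (subst bilinear_expand[OF b]) (simp add: sum_4 d n algebra_simps)
qed

lemma two_form_blocks:
  assumes "\<phi> \<in> two_forms"
  shows "\<phi> x y = 1/2 * (\<Sum>i\<in>UNIV. component 1 i \<phi> * form 1 i x y)
    + 1/2 * (\<Sum>i\<in>UNIV. component (-1) i \<phi> * form (-1) i x y)"
  by (subst two_form_coords[OF assms]) (simp add: sum_3 component_def form_def Let_def algebra_simps)

lemma A_two_form: "A x y \<in> two_forms" "(\<lambda>x y. A x y z v) \<in> two_forms"
  using bilinear_A A_swap12 A_swap34 unfolding two_forms_def by blast+

lemma component_linear: "component s i (\<lambda>x y. a * f x y) = a * component s i f"
   "component s i (\<lambda>x y. f x y + g x y) = component s i f + component s i g"
  by (simp_all add: component_def algebra_simps)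

lemma component_sum: "component s i (\<lambda>x y. \<Sum>j\<in>J. f j x y) = (\<Sum>j\<in>J. component s i (f j))"
  by (simp add: component_def sum.distrib sum_subtractf sum_distrib_left)

lemma form_swap: "form s i y x = - form s i x y"
  by (simp add: form_def Let_def algebra_simps)

lemma form_bilinear: "bilinear (form s i)"
  unfolding bilinear_def form_def Let_def by (auto intro!: linearI simp: algebra_simps)

lemma form_two_form: "form s i \<in> two_forms"
  using form_bilinear form_swap unfolding two_forms_def by blast

lemma component_A_two_form: "(\<lambda>x y. component t j (A x y)) \<in> two_forms"
proof -
  have "component t j (A x y) = - component t j (A y x)" for x y
    unfolding component_def A_swap12[of x y] by simp
  moreover have "linear (\<lambda>y. component t j (A x y))" "linear (\<lambda>x. component t j (A x y))" for x y
    by (auto intro!: linearI simp: component_def A_add A_cmul algebra_simps)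
  ultimately show ?thesis unfolding two_forms_def bilinear_def by blast
qed

lemma A_blocks:
  "A x y z v = 1/4 *
    (\<Sum>t\<in>{1,-1}. \<Sum>j\<in>UNIV. \<Sum>s\<in>{1,-1}. \<Sum>i\<in>UNIV. block s t i j * form s i x y * form t j z v)"
proof -
  have "A x y z v = 1/2 * (\<Sum>t\<in>{1,-1}. \<Sum>j\<in>UNIV. component t j (A x y) * form t j z v)"
    using two_form_blocks[OF A_two_form(1), of x y z v] by simp
  moreover have "component t j (A x y) = 1/2 * (\<Sum>s\<in>{1,-1}. \<Sum>i\<in>UNIV. block s t i j * form s i x y)" for t j
    using two_form_blocks[OF component_A_two_form[of t j], of x y] by (simp add: block_def)
  ultimately show ?thesis
    by (simp only: sum_distrib_left sum_distrib_right mult.assoc) simp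
qed

lemma block_sym: "block s t i j = block t s j i"
  using exhaust_3[of i] exhaust_3[of j]
  by (auto simp: block_def component_def A_normal algebra_simps)

lemma ricci_components:
  "ricci ip A (e 1) (e 1) = A (e 1) (e 2) (e 1) (e 2) - A (e 1) (e 3) (e 1) (e 3) - A (e 1) (e 4) (e 1) (e 4)"
  "ricci ip A (e 2) (e 2) = A (e 1) (e 2) (e 1) (e 2) - A (e 2) (e 3) (e 2) (e 3) - A (e 2) (e 4) (e 2) (e 4)"
  "ricci ip A (e 3) (e 3) = A (e 1) (e 3) (e 1) (e 3) + A (e 2) (e 3) (e 2) (e 3) - A (e 3) (e 4) (e 3) (e 4)"
  "ricci ip A (e 4) (e 4) = A (e 1) (e 4) (e 1) (e 4) + A (e 2) (e 4) (e 2) (e 4) - A (e 3) (e 4) (e 3) (e 4)"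
  "ricci ip A (e 1) (e 2) = - A (e 1) (e 3) (e 2) (e 3) - A (e 1) (e 4) (e 2) (e 4)"
  "ricci ip A (e 1) (e 3) = - A (e 1) (e 2) (e 2) (e 3) - A (e 1) (e 4) (e 3) (e 4)"
  "ricci ip A (e 1) (e 4) = - A (e 1) (e 2) (e 2) (e 4) + A (e 1) (e 3) (e 3) (e 4)"
  "ricci ip A (e 2) (e 3) = A (e 1) (e 2) (e 1) (e 3) - A (e 2) (e 4) (e 3) (e 4)"
  "ricci ip A (e 2) (e 4) = A (e 1) (e 2) (e 1) (e 4) + A (e 2) (e 3) (e 3) (e 4)"
  "ricci ip A (e 3) (e 4) = A (e 1) (e 3) (e 1) (e 4) + A (e 2) (e 3) (e 2) (e 4)"
  by (simp_all add: ricci_orthonormal sum_4 A_normal)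

lemma ricci_sym: "ricci ip A x y = ricci ip A y x"
proof -
  have "A (e i) x y (e i) = A (e i) y x (e i)" for i
    using A_pairs[of "e i" x y "e i"] A_swap12[of y "e i" "e i" x] A_swap34[of "e i" y "e i" x] by simp
  then show ?thesis by (simp add: ricci_orthonormal)
qed

text \<open>The nine trace-free Ricci equations are linear combinations of the nine entries of the mixed
  block, and conversely.\<close>

lemma mixed_block_zero:
  assumes "\<And>x y. ricci ip A x y = c * ip x y"
  shows "block 1 (-1) i j = 0"
proof -
  have "ricci ip A (e k) (e l) = c * ip (e k) (e l)" for k l by (rule assms)
  note r = this[of 1 1] this[of 2 2] this[of 3 3] this[of 4 4] this[of 1 2] this[of 1 3]
    this[of 1 4] this[of 2 3] this[of 2 4] this[of 3 4]
  have r: "block 1 (-1) 1 1 = 0 \<and> block 1 (-1) 1 2 = 0 \<and> block 1 (-1) 1 3 = 0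
    \<and> block 1 (-1) 2 1 = 0 \<and> block 1 (-1) 2 2 = 0 \<and> block 1 (-1) 2 3 = 0
    \<and> block 1 (-1) 3 1 = 0 \<and> block 1 (-1) 3 2 = 0 \<and> block 1 (-1) 3 3 = 0"
    using r unfolding ricci_components ip_basis_pair block_def component_def A_normal
    by (intro conjI; simp; linarith)
  then show ?thesis
    using exhaust_3[of i] exhaust_3[of j] by (elim disjE) simp_all
qed

end

section \<open>The Hodge operator and self-duality\<close>

context orthonormal_model
begin

text \<open>In these coordinates the inner product is diagonal on both summands; the wedge product below is
  the same expression with the opposite sign on the second summand. Comparing the two shows that the
  Hodge operator is the identity on the first summand and minus the identity on the second.\<close>

lemma form_ip_component:
  assumes "\<phi> \<in> two_forms" "\<theta> \<in> two_forms"
  shows "form_ip ip \<phi> \<theta> =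
    1/2 * (\<Sum>i\<in>UNIV. \<epsilon> i * (component 1 i \<phi> * component 1 i \<theta> + component (-1) i \<phi> * component (-1) i \<theta>))"
proof -
  have b: "bilinear \<phi>" "bilinear \<theta>" and a: "\<And>x y. \<phi> x y = - \<phi> y x" "\<And>x y. \<theta> x y = - \<theta> y x"
    using assms unfolding two_forms_def by blast+
  have l: "linear (\<phi> x)" "linear (\<lambda>x. \<phi> x y)" "linear (\<theta> x)" "linear (\<lambda>x. \<theta> x y)" for x y
    using b by (auto simp: bilinear_def)
  have "bilinear (\<lambda>c d. \<phi> x c * \<theta> y d)" for x y
    using l unfolding bilinear_def
    by (auto intro!: linearI simp: linear_add[OF l(1)] linear_add[OF l(3)] linear_cmul[OF l(1)] linear_cmul[OF l(3)] algebra_simps)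
  then have 1: "contract ip (\<lambda>c d. \<phi> x c * \<theta> y d) = (\<Sum>k\<in>UNIV. \<eta> k * (\<phi> x (e k) * \<theta> y (e k)))" for x y
    by (rule contract_orthonormal)
  have "bilinear (\<lambda>x y. \<Sum>k\<in>UNIV. \<eta> k * (\<phi> x (e k) * \<theta> y (e k)))"
    unfolding bilinear_def
    by (auto intro!: linearI simp: linear_add[OF l(2)] linear_add[OF l(4)] linear_cmul[OF l(2)] linear_cmul[OF l(4)]
        sum.distrib sum_distrib_left algebra_simps)
  then have 2: "form_ip ip \<phi> \<theta> = 1/2 * (\<Sum>i\<in>UNIV. \<eta> i * (\<Sum>k\<in>UNIV. \<eta> k * (\<phi> (e i) (e k) * \<theta> (e i) (e k))))"
    unfolding form_ip_def 1 by (subst contract_orthonormal) simp_all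
  have d: "\<phi> x x = 0" "\<theta> x x = 0" for x using a(1)[of x x] a(2)[of x x] by linarith+
  have n: "\<phi> (e 2) (e 1) = - \<phi> (e 1) (e 2)" "\<phi> (e 3) (e 1) = - \<phi> (e 1) (e 3)"
    "\<phi> (e 4) (e 1) = - \<phi> (e 1) (e 4)" "\<phi> (e 3) (e 2) = - \<phi> (e 2) (e 3)"
    "\<phi> (e 4) (e 2) = - \<phi> (e 2) (e 4)" "\<phi> (e 4) (e 3) = - \<phi> (e 3) (e 4)"
    "\<theta> (e 2) (e 1) = - \<theta> (e 1) (e 2)" "\<theta> (e 3) (e 1) = - \<theta> (e 1) (e 3)"
    "\<theta> (e 4) (e 1) = - \<theta> (e 1) (e 4)" "\<theta> (e 3) (e 2) = - \<theta> (e 2) (e 3)"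
    "\<theta> (e 4) (e 2) = - \<theta> (e 2) (e 4)" "\<theta> (e 4) (e 3) = - \<theta> (e 3) (e 4)"
    by (rule a)+
  show ?thesis
    unfolding 2 by (simp add: sum_3 sum_4 component_def \<epsilon>_def d n algebra_simps)
qed

lemma wedge_component:
  assumes "\<phi> \<in> two_forms" "\<psi> \<in> two_forms"
  shows "wedge \<phi> \<psi> x =
    1/2 * (\<Sum>i\<in>UNIV. \<epsilon> i * (component 1 i \<phi> * component 1 i \<psi> - component (-1) i \<phi> * component (-1) i \<psi>)) * vol_form e x"
proof -
  have a: "\<And>x y. \<phi> x y = - \<phi> y x" "\<And>x y. \<psi> x y = - \<psi> y x"
    using assms unfolding two_forms_def by blast+
  have m: "\<theta> x y = combine_minors (\<lambda>i j. \<theta> (e i) (e j)) (\<lambda>i. co i x) (\<lambda>i. co i y)"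
    if "\<theta> \<in> two_forms" for \<theta> x y
    by (subst two_form_coords[OF that]) (simp add: combine_minors_def minor_def)
  have "wedge \<phi> \<psi> x = shuffle_product (combine_minors (\<lambda>i j. \<phi> (e i) (e j))) (combine_minors (\<lambda>i j. \<psi> (e i) (e j)))
    (\<lambda>i. co i (x 1)) (\<lambda>i. co i (x 2)) (\<lambda>i. co i (x 3)) (\<lambda>i. co i (x 4))"
    unfolding wedge_4[OF a] shuffle_product_def m[OF assms(1), of "x _" "x _"] m[OF assms(2), of "x _" "x _"]
    by (rule refl)
  also have "\<dots> = 1/2 * (\<Sum>i\<in>UNIV. \<epsilon> i * (component 1 i \<phi> * component 1 i \<psi> - component (-1) i \<phi> * component (-1) i \<psi>)) * vol_form e x"
    unfolding shuffle_product_combine_minors vol_form_def det_4_shuffle[of "\<lambda>j i. co i (x j)"]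
    by (simp add: sum_3 component_def \<epsilon>_def algebra_simps)
  finally show ?thesis .
qed

lemma component_form: "component s i (form t j) = (if i = j then 1 + s * t else 0)"
  using exhaust_3[of i] exhaust_3[of j] by (auto simp: component_def form_def Let_def)

lemma two_form_eqI:
  assumes "\<phi> \<in> two_forms" "\<psi> \<in> two_forms"
    "\<And>i. component 1 i \<phi> = component 1 i \<psi>" "\<And>i. component (-1) i \<phi> = component (-1) i \<psi>"
  shows "\<phi> = \<psi>"
  by (intro ext) (simp only: two_form_blocks[OF assms(1)] two_form_blocks[OF assms(2)] assms(3,4))

lemma two_forms_linear:
  assumes "\<phi> \<in> two_forms" "\<psi> \<in> two_forms"
  shows "(\<lambda>x y. a * \<phi> x y + b * \<psi> x y) \<in> two_forms"
proof -
  have s: "bilinear \<phi>" "bilinear \<psi>" "\<And>x y. \<phi> x y = - \<phi> y x" "\<And>x y. \<psi> x y = - \<psi> y x"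
    using assms unfolding two_forms_def by blast+
  have l: "linear (\<phi> x)" "linear (\<lambda>x. \<phi> x y)" "linear (\<psi> x)" "linear (\<lambda>x. \<psi> x y)" for x y
    using s(1,2) by (auto simp: bilinear_def)
  have "bilinear (\<lambda>x y. a * \<phi> x y + b * \<psi> x y)"
    unfolding bilinear_def
    by (auto intro!: linearI simp: l[THEN linear_add] l[THEN linear_cmul] algebra_simps)
  moreover have "a * \<phi> x y + b * \<psi> x y = - (a * \<phi> y x + b * \<psi> y x)" for x y
    by (simp add: s(3)[of x y] s(4)[of x y])
  ultimately show ?thesis unfolding two_forms_def by blast
qed

lemma two_forms_sum:
  assumes "\<And>i. f i \<in> two_forms"
  shows "(\<lambda>x y. \<Sum>i\<in>(UNIV::3 set). g i * f i x y) \<in> two_forms"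
  using two_forms_linear[OF two_forms_linear[OF assms assms, of "g 1" 1 "g 2" 2] assms, of 1 "g 3" 3]
  by (simp add: sum_3)

lemma hodge_component:
  assumes Or: "Or \<in> orientations" "e \<in> Or" and \<theta>: "\<theta> \<in> two_forms"
  shows "hodge ip Or \<theta> \<in> two_forms" "component 1 i (hodge ip Or \<theta>) = component 1 i \<theta>"
    "component (-1) i (hodge ip Or \<theta>) = - component (-1) i \<theta>"
proof -
  \<comment> \<open>The candidate keeps the self-dual part and negates the anti-self-dual part.\<close>
  define \<psi> where "\<psi> = (\<lambda>x y. 1/2 * (\<Sum>i\<in>UNIV. component 1 i \<theta> * form 1 i x y)
    + (-1/2) * (\<Sum>i\<in>UNIV. component (-1) i \<theta> * form (-1) i x y))"
  have \<psi>: "\<psi> \<in> two_forms"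
    unfolding \<psi>_def by (intro two_forms_linear two_forms_sum form_two_form)
  have component\<psi>: "component 1 i \<psi> = component 1 i \<theta>" "component (-1) i \<psi> = - component (-1) i \<theta>" for i
    unfolding \<psi>_def by (simp_all only: component_linear component_sum component_form) (simp_all add: sum.delta' if_distrib cong: if_cong)
  let ?P = "\<lambda>\<psi>. \<psi> \<in> two_forms \<and> (\<forall>e\<in>Or. orthonormal_basis ip e \<longrightarrow>
       (\<forall>\<phi>\<in>two_forms. \<forall>x. wedge \<phi> \<psi> x = form_ip ip \<phi> \<theta> * vol_form e x))"
  have "hodge ip Or \<theta> = \<psi>"
    unfolding hodge_def
  proof (rule the_equality)
    have "wedge \<phi> \<psi> x = form_ip ip \<phi> \<theta> * vol_form e x" if "\<phi> \<in> two_forms" for \<phi> x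
      by (simp add: wedge_component[OF that \<psi>] form_ip_component[OF that \<theta>] component\<psi>)
    then show "?P \<psi>" using \<psi> vol_form_orthonormal[OF Or] by simp
  next
    fix \<psi>' assume P: "?P \<psi>'"
    then have \<psi>': "\<psi>' \<in> two_forms" by simp
    have vol: "vol_form e e = 1"
      using det_coord_inverse[OF basis basis] det_coord_same_orientation_pos[OF Or Or(2)]
      by (simp add: vol_form_def power2_eq_1_iff flip: power2_eq_square)
    have *: "(\<Sum>i\<in>UNIV. \<epsilon> i * (component 1 i \<phi> * component 1 i \<psi>' - component (-1) i \<phi> * component (-1) i \<psi>'))
      = (\<Sum>i\<in>UNIV. \<epsilon> i * (component 1 i \<phi> * component 1 i \<theta> + component (-1) i \<phi> * component (-1) i \<theta>))" if "\<phi> \<in> two_forms" for \<phi>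
    proof -
      have "wedge \<phi> \<psi>' e = form_ip ip \<phi> \<theta> * vol_form e e" using P that Or onb by blast
      then show ?thesis unfolding wedge_component[OF that \<psi>'] form_ip_component[OF that \<theta>] vol by simp
    qed
    \<comment> \<open>Testing against each of the six forms isolates one component at a time.\<close>
    have "component 1 i \<psi>' = component 1 i \<theta> \<and> component (-1) i \<psi>' = - component (-1) i \<theta>" for i
      using *[OF form_two_form[of 1 i]] *[OF form_two_form[of "-1" i]] exhaust_3[of i]
      by (auto simp: component_form sum_3 \<epsilon>_def)
    then show "\<psi>' = \<psi>" by (intro two_form_eqI \<psi> \<psi>') (simp_all add: component\<psi>)
  qed
  then show "hodge ip Or \<theta> \<in> two_forms" "component 1 i (hodge ip Or \<theta>) = component 1 i \<theta>"
    "component (-1) i (hodge ip Or \<theta>) = - component (-1) i \<theta>" using \<psi> component\<psi> by simp_all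
qed

lemma anti_self_dual_iff:
  assumes Or: "Or \<in> orientations" "e \<in> Or"
  shows "\<phi> \<in> anti_self_dual_forms ip Or \<longleftrightarrow> \<phi> \<in> two_forms \<and> (\<forall>i. component 1 i \<phi> = 0)"
proof (cases "\<phi> \<in> two_forms")
  case True
  note h = hodge_component[OF Or True]
  have neg: "(\<lambda>x y. - \<phi> x y) \<in> two_forms" using two_forms_linear[OF True True, of "-1" 0] by simp
  have cneg: "component s i (\<lambda>x y. - \<phi> x y) = - component s i \<phi>" for s i
    using component_linear(1)[of s i "-1" \<phi>] by simp
  have "hodge ip Or \<phi> = (\<lambda>x y. - \<phi> x y) \<longleftrightarrow> (\<forall>i. component 1 i \<phi> = 0)"
  proof
    assume eq: "hodge ip Or \<phi> = (\<lambda>x y. - \<phi> x y)"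
    show "\<forall>i. component 1 i \<phi> = 0" using h(2) unfolding eq cneg by simp
  qed (auto intro!: two_form_eqI[OF h(1) neg] simp: h cneg)
  then show ?thesis using True by (simp add: anti_self_dual_forms_def)
qed (simp add: anti_self_dual_forms_def)

text \<open>For an Einstein model the Weyl tensor is the curvature tensor minus the constant-curvature tensor
  with the same scalar curvature \<open>4 c\<close>.\<close>

lemma weyl_einstein:
  assumes "\<And>x y. ricci ip A x y = c * ip x y"
  shows "weyl ip A z v x y = A z v x y - c/3 * (ip v x * ip z y - ip z x * ip v y)"
proof -
  have "scalar_curvature ip A = 4 * c"
    by (simp add: scalar_orthonormal assms sum_4 ip_basis_pair)
  then show ?thesis by (simp add: weyl_def assms algebra_simps)
qed

text \<open>The constant-curvature tensor acts on two-forms as minus the identity; the factor \<open>\<epsilon>\<close> comes from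
  the lengths of the basis forms.\<close>

lemma component_const_curvature:
  "component s j (\<lambda>z v. ip v x * ip z y - ip z x * ip v y) = - \<epsilon> j * form s j x y"
  using exhaust_3[of j]
  by (auto simp: component_def form_def Let_def \<epsilon>_def ip_basis_right ip_commute[of "e _"] algebra_simps)

lemma const_curvature_two_form: "(\<lambda>z v. ip v x * ip z y - ip z x * ip v y) \<in> two_forms"
  unfolding two_forms_def bilinear_def by (auto intro!: linearI simp: ip_simps algebra_simps)

lemma self_dual_iff_component:
  assumes Or: "Or \<in> orientations" "e \<in> Or" and ein: "\<And>x y. ricci ip A x y = c * ip x y"
  shows "self_dual ip A Or \<longleftrightarrow> (\<forall>j x y. component (-1) j (\<lambda>z v. A z v x y) = - (c/3) * \<epsilon> j * form (-1) j x y)"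
proof -
  have W2: "(\<lambda>z v. weyl ip A z v x y) \<in> two_forms" for x y
    unfolding weyl_einstein[OF ein]
    using two_forms_linear[OF A_two_form(2) const_curvature_two_form, of 1 x y "-c/3" x y] by simp
  have cW: "component s j (\<lambda>z v. weyl ip A z v x y) = component s j (\<lambda>z v. A z v x y) + c/3 * \<epsilon> j * form s j x y" for s j x y
    unfolding weyl_einstein[OF ein]
    using component_linear(2)[of s j "\<lambda>z v. A z v x y" "\<lambda>z v. - (c/3) * (ip v x * ip z y - ip z x * ip v y)"]
      component_linear(1)[of s j "- (c/3)" "\<lambda>z v. ip v x * ip z y - ip z x * ip v y"]
    by (simp add: component_const_curvature)
  have op: "weyl_op ip A \<phi> x y = 1/2 * (\<Sum>i\<in>UNIV. \<epsilon> i * component (-1) i \<phi> * component (-1) i (\<lambda>z v. weyl ip A z v x y))"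
    if "\<phi> \<in> two_forms" "\<And>i. component 1 i \<phi> = 0" for \<phi> x y
    unfolding weyl_op_def form_ip_component[OF that(1) W2] by (simp add: that(2) mult.assoc)
  have "self_dual ip A Or \<longleftrightarrow> (\<forall>j x y. component (-1) j (\<lambda>z v. weyl ip A z v x y) = 0)"
  proof
    assume sd: "self_dual ip A Or"
    show "\<forall>j x y. component (-1) j (\<lambda>z v. weyl ip A z v x y) = 0"
    proof (intro allI)
      fix j x y
      have "form (-1) j \<in> anti_self_dual_forms ip Or"
        unfolding anti_self_dual_iff[OF Or] by (simp add: form_two_form component_form)
      then have "weyl_op ip A (form (-1) j) x y = 0" using sd by (simp add: self_dual_def)
      then show "component (-1) j (\<lambda>z v. weyl ip A z v x y) = 0"
        using exhaust_3[of j] by (auto simp: op form_two_form component_form sum_3 \<epsilon>_def)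
    qed
  next
    assume "\<forall>j x y. component (-1) j (\<lambda>z v. weyl ip A z v x y) = 0"
    then show "self_dual ip A Or"
      unfolding self_dual_def by (auto intro!: ext simp: op anti_self_dual_iff[OF Or])
  qed
  then show ?thesis unfolding cW by (simp add: add_eq_0_iff2)
qed

lemma component_A_right: "component s i (\<lambda>x y. component t j (\<lambda>z v. A z v x y)) = block s t i j"
proof -
  have "(\<lambda>z v. A z v x y) = A x y" for x y by (intro ext A_pairs)
  then show ?thesis by (simp add: block_def)
qed

lemma self_dual_iff_block:
  assumes Or: "Or \<in> orientations" "e \<in> Or" and ein: "\<And>x y. ricci ip A x y = c * ip x y"
  shows "self_dual ip A Or \<longleftrightarrow> (\<forall>i j. block (-1) (-1) i j = (if i = j then - (2*c/3) * \<epsilon> i else 0))"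
proof -
  have l: "(\<lambda>x y. component (-1) j (\<lambda>z v. A z v x y)) \<in> two_forms" for j
  proof -
    have "(\<lambda>z v. A z v x y) = A x y" for x y by (intro ext A_pairs)
    then show ?thesis using component_A_two_form[of "-1" j] by simp
  qed
  have r: "(\<lambda>x y. - (c/3) * \<epsilon> j * form (-1) j x y) \<in> two_forms" for j
    using two_forms_linear[OF form_two_form form_two_form, of "- (c/3) * \<epsilon> j" "-1" j 0 1 j] by simp
  have "(\<forall>x y. component (-1) j (\<lambda>z v. A z v x y) = - (c/3) * \<epsilon> j * form (-1) j x y)
    \<longleftrightarrow> (\<forall>i. block (-1) (-1) i j = (if i = j then - (2*c/3) * \<epsilon> i else 0))" (is "?L \<longleftrightarrow> ?R") for j
  proof
    assume ?L
    then have "(\<lambda>x y. component (-1) j (\<lambda>z v. A z v x y)) = (\<lambda>x y. - (c/3) * \<epsilon> j * form (-1) j x y)" by (intro ext) blast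
    then have "block (-1) (-1) i j = component (-1) i (\<lambda>x y. - (c/3) * \<epsilon> j * form (-1) j x y)" for i
      unfolding component_A_right[symmetric] by (rule arg_cong)
    then show ?R unfolding component_linear(1) component_form by simp
  next
    assume R: ?R
    have "(\<lambda>x y. component (-1) j (\<lambda>z v. A z v x y)) = (\<lambda>x y. - (c/3) * \<epsilon> j * form (-1) j x y)"
    proof (rule two_form_eqI[OF l r])
      show "component 1 i (\<lambda>x y. component (-1) j (\<lambda>z v. A z v x y)) = component 1 i (\<lambda>x y. - (c/3) * \<epsilon> j * form (-1) j x y)" for i
        unfolding component_A_right component_linear(1) component_form mixed_block_zero[OF ein] by simp
      show "component (-1) i (\<lambda>x y. component (-1) j (\<lambda>z v. A z v x y)) = component (-1) i (\<lambda>x y. - (c/3) * \<epsilon> j * form (-1) j x y)" for i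
        unfolding component_A_right component_linear(1) component_form using R by simp
    qed
    then show ?L by meson
  qed
  then show ?thesis unfolding self_dual_iff_component[OF assms] by blast
qed

text \<open>The Bianchi identity equates the traces of the two diagonal blocks, and the Einstein constant is
  their sum up to a factor. A scalar anti-self-dual block is therefore automatically that of the
  constant-curvature part, with no freedom left for the scalar.\<close>

lemma block_trace:
  assumes ein: "\<And>x y. ricci ip A x y = c * ip x y"
    and "\<And>i j. block (-1) (-1) i j = (if i = j then k * \<epsilon> i else 0)"
  shows "k = - (2*c/3)"
proof -
  have "ricci ip A (e i) (e j) = c * ip (e i) (e j)" for i j by (rule ein)
  note r = this[of 1 1] this[of 2 2] this[of 3 3] this[of 4 4]
  show ?thesis
    using assms(2)[of 1 1] assms(2)[of 2 2] assms(2)[of 3 3] r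
    unfolding ricci_components ip_basis_pair block_def component_def A_normal \<epsilon>_def by simp
qed

end

section \<open>Self-dual Einstein models: the Jacobi operators\<close>

context orthonormal_model
begin

text \<open>The skew operators that correspond to the forms. For either value of \<open>s\<close> the first squares to
  minus the identity and the other two to the identity: they generate the split quaternions.\<close>

definition rot :: "real \<Rightarrow> 3 \<Rightarrow> 'v \<Rightarrow> 'v" where
  "rot s i v = (\<Sum>k\<in>UNIV. (\<eta> k * form s i (e k) v) *\<^sub>R e k)"

lemma co_rot: "co j (rot s i v) = \<eta> j * form s i (e j) v"
  using exhaust_4[of j] by (auto simp: rot_def sum_4)

lemma ip_rot: "ip y (rot s i v) = form s i y v"
  unfolding ip_coords co_rot by (simp add: form_def Let_def algebra_simps)

lemma form_self [simp]: "form s i v v = 0"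
  by (simp add: form_def Let_def)

lemma ip_rot_rot:
  assumes "s \<in> {1, -1}"
  shows "ip (rot s i v) (rot s j v) = (if i = j then \<epsilon> i * ip v v else 0)"
  using exhaust_3[of i] exhaust_3[of j] assms
  by (auto simp: ip_coords co_rot form_def Let_def \<epsilon>_def algebra_simps)

text \<open>The right-hand side does not depend on \<open>s\<close>. This is why, in Jacobi operators, a scalar
  anti-self-dual block can be traded for the same scalar in the self-dual block.\<close>

lemma sum_form_form:
  assumes "s \<in> {1, -1}"
  shows "(\<Sum>i\<in>UNIV. \<epsilon> i * form s i y v * form s i z v) = ip v v * ip y z - ip y v * ip z v"
  using assms by (auto simp: sum_3 ip_coords form_def Let_def \<epsilon>_def algebra_simps)

text \<open>The split-quaternionic orthogonal frame attached to a vector.\<close>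

definition rot_frame :: "'v \<Rightarrow> 4 \<Rightarrow> 'v" where
  "rot_frame v i = (if i = 1 then v else if i = 2 then rot 1 1 v else if i = 3 then rot 1 2 v else rot 1 3 v)"

lemma is_basis_rot_frame:
  assumes "ip v v \<noteq> 0"
  shows "is_basis (rot_frame v)"
proof (rule orthogonal_is_basis)
  have 0: "ip v (rot 1 i v) = 0" "ip (rot 1 i v) v = 0" for i
    using ip_rot[of v 1 i v] ip_commute[of v] by simp_all
  show "ip (rot_frame v i) (rot_frame v j) = 0" if "i \<noteq> j" for i j
    using that exhaust_4[of i] exhaust_4[of j] by (auto simp: rot_frame_def ip_rot_rot 0)
  show "ip (rot_frame v i) (rot_frame v i) \<noteq> 0" for i
    using assms by (simp add: rot_frame_def ip_rot_rot \<epsilon>_def)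
  fix y
  define a where "a = (\<lambda>i::4. if i = 1 then ip y v / ip v v
      else if i = 2 then \<epsilon> 1 * form 1 1 y v / ip v v else if i = 3 then \<epsilon> 2 * form 1 2 y v / ip v v
      else \<epsilon> 3 * form 1 3 y v / ip v v)"
  \<comment> \<open>The expansion of a vector in an orthogonal frame, multiplied by the squared length.\<close>
  have "ip v v *\<^sub>R y = ip y v *\<^sub>R v + (\<Sum>i\<in>UNIV. (\<epsilon> i * form 1 i y v) *\<^sub>R rot 1 i v)"
  proof (rule ip_eqI)
    fix z
    have "ip (ip y v *\<^sub>R v + (\<Sum>i\<in>UNIV. (\<epsilon> i * form 1 i y v) *\<^sub>R rot 1 i v)) z
      = ip y v * ip v z + (\<Sum>i\<in>UNIV. \<epsilon> i * form 1 i y v * form 1 i z v)"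
      by (simp add: ip_simps linear_sum[OF ip_linear(2)] ip_commute[of "rot 1 _ v" z] ip_rot)
    then show "ip (ip v v *\<^sub>R y) z = ip (ip y v *\<^sub>R v + (\<Sum>i\<in>UNIV. (\<epsilon> i * form 1 i y v) *\<^sub>R rot 1 i v)) z"
      by (simp add: sum_form_form ip_simps ip_commute[of v z])
  qed
  then have "y = (1 / ip v v) *\<^sub>R (ip y v *\<^sub>R v + (\<Sum>i\<in>UNIV. (\<epsilon> i * form 1 i y v) *\<^sub>R rot 1 i v))"
    using assms by (metis eq_vector_fraction_iff scaleR_one)
  also have "\<dots> = (\<Sum>i\<in>UNIV. a i *\<^sub>R rot_frame v i)"
    by (simp add: sum_3 sum_4 rot_frame_def a_def scaleR_add_right)
  finally show "\<exists>a. y = (\<Sum>i\<in>UNIV. a i *\<^sub>R rot_frame v i)" by (rule exI[of _ a])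
qed

lemma jacobi_rot:
  assumes "\<And>y v z. A y v v z = (\<Sum>i\<in>UNIV. \<Sum>j\<in>UNIV. b i j * form 1 i y v * form 1 j z v)"
  shows "jacobi_op ip A v y = (\<Sum>i\<in>UNIV. \<Sum>j\<in>UNIV. (b i j * form 1 i y v) *\<^sub>R rot 1 j v)"
  by (rule ip_eqI) (simp add: jacobi_ip assms ip_simps linear_sum[OF ip_linear(2)] ip_commute[of "rot 1 _ v"] ip_rot)

lemma jacobi_rot_rot:
  assumes "\<And>y v z. A y v v z = (\<Sum>i\<in>UNIV. \<Sum>j\<in>UNIV. b i j * form 1 i y v * form 1 j z v)"
  shows "jacobi_op ip A v (rot 1 k v) = (ip v v * \<epsilon> k) *\<^sub>R (\<Sum>j\<in>UNIV. b k j *\<^sub>R rot 1 j v)"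
proof -
  have "form 1 i (rot 1 k v) v = (if i = k then \<epsilon> k * ip v v else 0)" for i
    using ip_rot[of "rot 1 k v" 1 i v] by (auto simp: ip_rot_rot)
  then have "(\<Sum>j\<in>UNIV. (b i j * form 1 i (rot 1 k v) v) *\<^sub>R rot 1 j v)
    = (if i = k then (ip v v * \<epsilon> k) *\<^sub>R (\<Sum>j\<in>UNIV. b k j *\<^sub>R rot 1 j v) else 0)" for i
    by (auto simp: scaleR_sum_right mult_ac)
  then show ?thesis by (simp add: jacobi_rot[OF assms])
qed

text \<open>The matrix depends on \<open>v\<close> through the factor \<open>\<langle>v, v\<rangle>\<close> only, which is the reason for the constancy of
  the Jordan form. The first row and column vanish because \<open>v\<close> lies in the kernel and the image is
  spanned by the rotated vectors; \<open>\<sigma>\<close> turns a position in the frame into the index of the rotation.\<close>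

lemma op_mat_jacobi_rot_frame:
  assumes A: "\<And>y v z. A y v v z = (\<Sum>i\<in>UNIV. \<Sum>j\<in>UNIV. b i j * form 1 i y v * form 1 j z v)"
  defines "\<sigma> \<equiv> \<lambda>i::4. if i = 2 then 1 else if i = 3 then 2 else (3::3)"
  defines "m \<equiv> \<lambda>i j. if i = 1 \<or> j = 1 then 0 else \<epsilon> (\<sigma> j) * b (\<sigma> j) (\<sigma> i)"
  assumes v: "ip v v \<noteq> 0"
  shows "op_mat (rot_frame v) (jacobi_op ip A v) =
    Matrix.mat 4 4 (\<lambda>(i, j). complex_of_real (ip v v * m (of_nat (Suc i)) (of_nat (Suc j))))"
proof -
  note f = is_basis_rot_frame[OF v]
  have "jacobi_op ip A v (rot_frame v j) = ip v v *\<^sub>R (\<Sum>i\<in>UNIV. m i j *\<^sub>R rot_frame v i)" for j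
  proof (cases "j = 1")
    case True
    then show ?thesis by (simp add: rot_frame_def jacobi_rot[OF A] m_def)
  next
    case False
    then have j: "rot_frame v j = rot 1 (\<sigma> j) v" by (simp add: rot_frame_def \<sigma>_def)
    have "(\<Sum>i\<in>UNIV. m i j *\<^sub>R rot_frame v i) = (\<Sum>k\<in>UNIV. (\<epsilon> (\<sigma> j) * b (\<sigma> j) k) *\<^sub>R rot 1 k v)"
      using False by (simp add: sum_3 sum_4 m_def rot_frame_def \<sigma>_def)
    then show ?thesis unfolding j jacobi_rot_rot[OF A] by (simp add: scaleR_sum_right mult.assoc)
  qed
  then have "coord (rot_frame v) i (jacobi_op ip A v (rot_frame v j)) = ip v v * m i j" for i j
    using linear_coord[OF f, of i]
    by (simp add: linear_sum linear_cmul coord_basis[OF f] sum_distrib_left if_distrib cong: if_cong)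
  then show ?thesis unfolding op_mat_def by simp
qed

lemma jordan_osserman_if_rot:
  assumes A: "\<And>y v z. A y v v z = (\<Sum>i\<in>UNIV. \<Sum>j\<in>UNIV. b i j * form 1 i y v * form 1 j z v)"
    and r: "r \<noteq> 0"
  shows "jordan_osserman_on {v. ip v v = r} ip A"
proof -
  let ?\<sigma> = "\<lambda>i::4. if i = 2 then 1 else if i = 3 then 2 else (3::3)"
  define M :: "complex mat" where "M = Matrix.mat 4 4 (\<lambda>(i, j). complex_of_real (r *
    (if of_nat (Suc i) = (1::4) \<or> of_nat (Suc j) = (1::4) then 0
     else \<epsilon> (?\<sigma> (of_nat (Suc j))) * b (?\<sigma> (of_nat (Suc j))) (?\<sigma> (of_nat (Suc i))))))"
  have "M \<in> carrier_mat 4 4" by (simp add: M_def)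
  then obtain n_as where n: "jordan_nf M n_as" using complex_jordan_nf_exists by blast
  have "has_jordan_form (jacobi_op ip A v) n_as" if "ip v v = r" for v
  proof -
    have v: "ip v v \<noteq> 0" using that r by simp
    have "op_mat (rot_frame v) (jacobi_op ip A v) = M"
      unfolding op_mat_jacobi_rot_frame[OF A v] M_def that ..
    then show ?thesis
      using n has_jordan_form_iff[OF linear_jacobi is_basis_rot_frame[OF v]] by simp
  qed
  then show ?thesis unfolding jordan_osserman_on_def by blast
qed

text \<open>The image of the Jacobi operator is spanned by the vectors \<open>I\<^sub>k v\<close>, and these are sent to multiples
  of \<open>\<langle>v, v\<rangle>\<close>; hence the square vanishes for null \<open>v\<close>.\<close>

lemma null_osserman_if_rot:
  assumes A: "\<And>y v z. A y v v z = (\<Sum>i\<in>UNIV. \<Sum>j\<in>UNIV. b i j * form 1 i y v * form 1 j z v)"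
  shows "null_osserman ip A"
proof -
  have "complex_eigenvalues (jacobi_op ip A v) = replicate_mset 4 0" if "ip v v = 0" for v
  proof (rule complex_eigenvalues_square_zero[OF basis linear_jacobi])
    have 0: "jacobi_op ip A v (rot 1 k v) = 0" for k
      using jacobi_rot_rot[OF A, of v k] that by simp
    fix y
    show "jacobi_op ip A v (jacobi_op ip A v y) = 0"
      unfolding jacobi_rot[OF A, of v y]
      by (simp add: linear_sum[OF linear_jacobi] linear_cmul[OF linear_jacobi] 0)
  qed
  then show ?thesis by (auto simp: null_osserman_def osserman_on_def null_vectors_def)
qed

text \<open>The mixed blocks drop out, and the scalar anti-self-dual block is absorbed into the self-dual one.\<close>

lemma jacobi_form_if_block:
  assumes ein: "\<And>x y. ricci ip A x y = c * ip x y"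
    and k: "\<And>i j. block (-1) (-1) i j = (if i = j then k * \<epsilon> i else 0)"
  shows "A y v v z = (\<Sum>i\<in>UNIV. \<Sum>j\<in>UNIV.
    - 1/4 * (block 1 1 i j + (if i = j then k * \<epsilon> i else 0)) * form 1 i y v * form 1 j z v)"
proof -
  have 0: "block 1 (-1) i j = 0" "block (-1) 1 i j = 0" for i j
    using mixed_block_zero[OF ein] block_sym by metis+
  have "(\<Sum>j\<in>UNIV. \<Sum>i\<in>UNIV. block (-1) (-1) i j * form (-1) i y v * form (-1) j v z)
    = - k * (\<Sum>i\<in>UNIV. \<epsilon> i * form (-1) i y v * form (-1) i z v)"
    by (simp add: k form_swap[of _ _ v z] sum_3)  (simp add: algebra_simps)
  also have "\<dots> = - k * (\<Sum>i\<in>UNIV. \<epsilon> i * form 1 i y v * form 1 i z v)"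
    by (simp add: sum_form_form)
  finally have "A y v v z = 1/4 * ((\<Sum>j\<in>UNIV. \<Sum>i\<in>UNIV. block 1 1 i j * form 1 i y v * form 1 j v z)
    - k * (\<Sum>i\<in>UNIV. \<epsilon> i * form 1 i y v * form 1 i z v))"
    by (subst A_blocks) (simp add: 0)
  also have "\<dots> = (\<Sum>i\<in>UNIV. \<Sum>j\<in>UNIV.
      - 1/4 * (block 1 1 i j + (if i = j then k * \<epsilon> i else 0)) * form 1 i y v * form 1 j z v)"
    by (simp add: sum_3 form_swap[of _ _ v z]) (simp add: field_simps)
  finally show ?thesis .
qed

end

section \<open>Traces of the Jacobi operators along null vectors\<close>

text \<open>A parametrization of the cone \<open>x\<^sub>1\<^sup>2 = x\<^sub>2\<^sup>2 + x\<^sub>3\<^sup>2\<close>.\<close>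

definition cone :: "real \<Rightarrow> real \<Rightarrow> 3 \<Rightarrow> real" where
  "cone p q i = (if i = 1 then p\<^sup>2 + q\<^sup>2 else if i = 2 then - 2 * p * q else q\<^sup>2 - p\<^sup>2)"

text \<open>A quadratic form that vanishes on the cone is a multiple of the form that defines it; five points
  of the cone determine this.\<close>

lemma quadratic_form_vanishing_on_cone:
  assumes sym: "\<And>i j. a i j = a j i"
    and zero: "\<And>p q. (\<Sum>i\<in>UNIV. \<Sum>j\<in>UNIV. a i j * cone p q i * cone p q j) = 0"
  shows "a i j = (if i = j then a 1 1 * (if i = 1 then 1 else -1) else 0)"
proof -
  have "a 2 1 = a 1 2" "a 3 1 = a 1 3" "a 3 2 = a 2 3" by (rule sym)+
  then have *: "a 1 1 * (cone p q 1)\<^sup>2 + a 2 2 * (cone p q 2)\<^sup>2 + a 3 3 * (cone p q 3)\<^sup>2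
     + 2 * a 1 2 * cone p q 1 * cone p q 2 + 2 * a 1 3 * cone p q 1 * cone p q 3
     + 2 * a 2 3 * cone p q 2 * cone p q 3 = 0" for p q
    using zero[of p q] by (simp add: sum_3 power2_eq_square algebra_simps)
  \<comment> \<open>The parameters give the points (2, -2, 0), (2, 2, 0), (1, 0, -1), (1, 0, 1) and (5, -4, -3).\<close>
  have 1: "a 1 2 = 0" "a 2 2 = - a 1 1"
    using *[of 1 1] *[of 1 "-1"] by (simp_all add: cone_def)
  have 2: "a 1 3 = 0" "a 3 3 = - a 1 1"
    using *[of 1 0] *[of 0 1] by (simp_all add: cone_def)
  have 3: "a 2 3 = 0"
    using *[of 2 1] by (simp add: cone_def 1 2)
  show ?thesis
    using 1 2 3 sym[of 2 1] sym[of 3 1] sym[of 3 2] exhaust_3[of i] exhaust_3[of j] by auto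
qed

context orthonormal_model
begin

definition jac :: "'v \<Rightarrow> 4 \<Rightarrow> 4 \<Rightarrow> real" where "jac v i j = A (e i) v v (e j)"

text \<open>The trace of the product of two symmetric operators, expressed by the bilinear forms that the
  metric associates with them.\<close>

definition pairing :: "(4 \<Rightarrow> 4 \<Rightarrow> real) \<Rightarrow> (4 \<Rightarrow> 4 \<Rightarrow> real) \<Rightarrow> real" where
  "pairing T U = (\<Sum>i\<in>UNIV. \<Sum>j\<in>UNIV. \<eta> i * \<eta> j * T i j * U i j)"

lemma ricci_jac: "ricci ip A v v = (\<Sum>i\<in>UNIV. \<eta> i * jac v i i)"
  by (simp add: ricci_orthonormal jac_def)

lemma jac_sym: "jac v i j = jac v j i"
  unfolding jac_def using A_pairs[of "e i" v v "e j"] A_swap12[of v "e j" "e i" v] A_swap34[of "e j" v "e i" v] by simp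

lemma coord_jacobi: "co i (jacobi_op ip A v (e j)) = \<eta> i * jac v i j"
proof -
  have "\<eta> i * co i (jacobi_op ip A v (e j)) = jac v j i"
    by (simp add: jacobi_ip jac_def flip: ip_basis_right)
  moreover have "\<eta> i * \<eta> i = 1" by (simp add: \<eta>_def)
  ultimately show ?thesis using jac_sym by (metis mult.assoc mult_1)
qed

lemma mat_trace_jacobi:
  "mat_trace (op_mat e (jacobi_op ip A v)) = of_real (ricci ip A v v)"
  "mat_trace (op_mat e (jacobi_op ip A v) * op_mat e (jacobi_op ip A v)) = of_real (pairing (jac v) (jac v))"
proof -
  let ?M = "op_mat e (jacobi_op ip A v)"
  have M: "?M \<in> carrier_mat 4 4" by (simp add: op_mat_def)
  have entry: "?M $$ (i, j) = of_real (\<eta> (of_nat (Suc i)) * jac v (of_nat (Suc i)) (of_nat (Suc j)))" if "i < 4" "j < 4" for i j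
    using that by (simp add: op_mat_def coord_jacobi del: of_nat_Suc)
  have "mat_trace ?M = (\<Sum>i = 0..<4. of_real (\<eta> (of_nat (Suc i)) * jac v (of_nat (Suc i)) (of_nat (Suc i))))"
    using M by (simp add: mat_trace_def entry atLeast0LessThan del: of_nat_Suc)
  also have "\<dots> = of_real (\<Sum>i\<in>UNIV. \<eta> i * jac v i i)"
    using sum_4_nat[of "\<lambda>i. \<eta> i * jac v i i"] by (simp only: of_real_sum[symmetric])
  finally show "mat_trace ?M = of_real (ricci ip A v v)" by (simp add: ricci_orthonormal jac_def)
  have "mat_trace (?M * ?M) = (\<Sum>i = 0..<4. \<Sum>j = 0..<4. of_real (\<eta> (of_nat (Suc i)) * jac v (of_nat (Suc i)) (of_nat (Suc j))
      * (\<eta> (of_nat (Suc j)) * jac v (of_nat (Suc j)) (of_nat (Suc i)))))"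
    unfolding mat_trace_mult[OF M M] by (simp add: entry atLeast0LessThan del: of_nat_Suc)
  also have "\<dots> = (\<Sum>i = 0..<4. of_real (\<Sum>j\<in>UNIV. \<eta> (of_nat (Suc i)) * jac v (of_nat (Suc i)) j * (\<eta> j * jac v j (of_nat (Suc i)))))"
    using sum_4_nat[of "\<lambda>j. \<eta> (of_nat (Suc i)) * jac v (of_nat (Suc i)) j * (\<eta> j * jac v j (of_nat (Suc i)))" for i]
    by (simp only: of_real_sum[symmetric])
  also have "\<dots> = of_real (\<Sum>i\<in>UNIV. \<Sum>j\<in>UNIV. \<eta> i * jac v i j * (\<eta> j * jac v j i))"
    using sum_4_nat[of "\<lambda>i. \<Sum>j\<in>UNIV. \<eta> i * jac v i j * (\<eta> j * jac v j i)"] by (simp only: of_real_sum[symmetric])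
  also have "(\<Sum>i\<in>UNIV. \<Sum>j\<in>UNIV. \<eta> i * jac v i j * (\<eta> j * jac v j i)) = pairing (jac v) (jac v)"
    unfolding pairing_def by (intro sum.cong refl) (simp add: jac_sym[of v])
  finally show "mat_trace (?M * ?M) = of_real (pairing (jac v) (jac v))" .
qed

lemma osserman_traces:
  assumes "osserman_on S ip A" "v \<in> S" "w \<in> S"
  shows "ricci ip A v v = ricci ip A w w" "pairing (jac v) (jac v) = pairing (jac w) (jac w)"
proof -
  have M: "op_mat e (jacobi_op ip A u) \<in> carrier_mat 4 4" for u by (simp add: op_mat_def)
  have "proots (char_poly (op_mat e (jacobi_op ip A v))) = proots (char_poly (op_mat e (jacobi_op ip A w)))"
    using assms by (auto simp: osserman_on_def complex_eigenvalues_eq[OF linear_jacobi basis])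
  then have "(of_real (ricci ip A v v) :: complex) = of_real (ricci ip A w w)"
    "(of_real (pairing (jac v) (jac v)) :: complex) = of_real (pairing (jac w) (jac w))"
    unfolding mat_trace_jacobi[symmetric] mat_trace_eq_sum_proots[OF M] by simp_all
  then show "ricci ip A v v = ricci ip A w w" "pairing (jac v) (jac v) = pairing (jac w) (jac w)"
    by simp_all
qed

lemma traces_scale:
  "ricci ip A (a *\<^sub>R v) (a *\<^sub>R v) = a^2 * ricci ip A v v"
  "pairing (jac (a *\<^sub>R v)) (jac (a *\<^sub>R v)) = a^4 * pairing (jac v) (jac v)"
  by (simp_all add: ricci_orthonormal pairing_def jac_def A_cmul sum_distrib_left power2_eq_square eval_nat_numeral mult_ac)

lemma isCont_jac: "isCont (\<lambda>t. jac (v + t *\<^sub>R u) i j) 0"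
  unfolding jac_def by (simp only: A_add A_cmul) (intro continuous_intros)

text \<open>A vector \<open>u\<close> with these properties makes \<open>\<langle>v + t u, v + t u\<rangle>\<close> equal to \<open>t r\<close>.\<close>

lemma null_companion:
  assumes "v \<noteq> 0"  "ip v v = 0" "r \<noteq> 0"
  obtains u where "ip u u = 0" "2 * ip v u = r"
proof -
  obtain y where y: "ip v y \<noteq> 0" using ip_nondegenerate assms(1) by blast
  define w where "w = (r / (2 * ip v y)) *\<^sub>R y"
  have w: "2 * ip v w = r" using y by (simp add: w_def ip_simps)
  define u where "u = w - (ip w w / r) *\<^sub>R v"
  have "2 * ip v u = r" using w by (simp add: u_def ip_simps assms)
  moreover have "ip u u = 0" using w assms by (simp add: u_def ip_simps ip_commute[of w v] field_simps)
  ultimately show ?thesis using that by blast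
qed

text \<open>The path \<open>w(t) = v + t u\<close> has squared length \<open>t r\<close>, so \<open>w(t) / \<surd>t\<close> stays in the quadric where
  the eigenvalues are constant. By homogeneity the two traces at \<open>w(t)\<close> are constants times \<open>t\<close> and
  \<open>t\<^sup>2\<close>; letting \<open>t\<close> tend to 0 gives the traces at \<open>v\<close>.\<close>

lemma osserman_null_traces:
  assumes O: "osserman_on {v. ip v v = r} ip A" and r: "r \<noteq> 0" and v: "v \<noteq> 0" "ip v v = 0"
  shows "ricci ip A v v = 0 \<and> pairing (jac v) (jac v) = 0"
proof -
  obtain u where u: "ip u u = 0" "2 * ip v u = r" using null_companion[OF v r] by blast
  define w where "w t = v + t *\<^sub>R u" for t
  have ipw: "ip (w t) (w t) = t * r" for t
    using u v by (simp add: w_def ip_simps ip_commute[of u v])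
  have eq: "ricci ip A (w t) (w t) = t * ricci ip A (w 1) (w 1) \<and>
    pairing (jac (w t)) (jac (w t)) = t^2 * pairing (jac (w 1)) (jac (w 1))" if "t > 0" for t
  proof -
    have "ip ((1 / sqrt t) *\<^sub>R w t) ((1 / sqrt t) *\<^sub>R w t) = r" "ip (w 1) (w 1) = r"
      using that by (simp_all add: ip_simps ipw)
    from osserman_traces[OF O, of "(1 / sqrt t) *\<^sub>R w t" "w 1"] this
    have "(1 / sqrt t)^2 * ricci ip A (w t) (w t) = ricci ip A (w 1) (w 1)"
      "(1 / sqrt t)^4 * pairing (jac (w t)) (jac (w t)) = pairing (jac (w 1)) (jac (w 1))"
      by (simp_all only: traces_scale mem_Collect_eq)
    moreover have "(1 / sqrt t)^2 = 1 / t" "(1 / sqrt t)^4 = 1 / t^2"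
      using that by (simp_all add: power_divide power2_eq_square eval_nat_numeral)
    ultimately show ?thesis using that by (simp add: field_simps)
  qed
  have lim0: "f 0 = 0" if "isCont f 0" "isCont g 0" "g 0 = 0" "\<And>t. t > 0 \<Longrightarrow> f t = g t" for f g :: "real \<Rightarrow> real"
  proof -
    have "(f \<longlongrightarrow> f 0) (at_right 0)" "(g \<longlongrightarrow> g 0) (at_right 0)"
      using that(1,2) by (auto simp: isCont_def intro: filterlim_at_within_If tendsto_mono[OF at_le])
    moreover have "\<forall>\<^sub>F t in at_right 0. f t = g t"
      unfolding eventually_at_right_field using that(4) by (intro exI[of _ 1]) auto
    ultimately have "(g \<longlongrightarrow> f 0) (at_right 0)" using tendsto_cong by blast
    then show ?thesis using tendsto_unique[of "at_right 0" g "f 0" "g 0"] \<open>(g \<longlongrightarrow> g 0) (at_right 0)\<close> that(3) by simp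
  qed
  have "ricci ip A (w 0) (w 0) = 0"
  proof (rule lim0[of "\<lambda>t. ricci ip A (w t) (w t)" "\<lambda>t. t * ricci ip A (w 1) (w 1)"])
    show "isCont (\<lambda>t. ricci ip A (w t) (w t)) 0"
      unfolding ricci_jac w_def by (intro continuous_intros isCont_jac)
    show "isCont (\<lambda>t. t * ricci ip A (w 1) (w 1)) 0" by (intro continuous_intros)
  qed (simp, use eq in blast)
  moreover have "pairing (jac (w 0)) (jac (w 0)) = 0"
  proof (rule lim0[of "\<lambda>t. pairing (jac (w t)) (jac (w t))" "\<lambda>t. t^2 * pairing (jac (w 1)) (jac (w 1))"])
    show "isCont (\<lambda>t. pairing (jac (w t)) (jac (w t))) 0"
      unfolding pairing_def w_def by (intro continuous_intros isCont_jac)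
    show "isCont (\<lambda>t. t\<^sup>2 * pairing (jac (w 1)) (jac (w 1))) 0" by (intro continuous_intros)
  qed (simp, use eq in blast)
  ultimately show ?thesis by (simp add: w_def)
qed

text \<open>The cone of null vectors is invariant under scaling, which multiplies the traces by 4 and 16 when
  the vector is doubled.\<close>

lemma null_osserman_null_traces:
  assumes O: "null_osserman ip A" and v: "v \<noteq> 0" "ip v v = 0"
  shows "ricci ip A v v = 0 \<and> pairing (jac v) (jac v) = 0"
  using osserman_traces[OF O[unfolded null_osserman_def], of v "2 *\<^sub>R v"] v
  by (simp add: null_vectors_def ip_simps traces_scale)

text \<open>A symmetric bilinear form that vanishes on the null cone is a multiple of the metric.\<close>

lemma einstein_if_ricci_null:
  assumes null: "\<And>v. ip v v = 0 \<Longrightarrow> ricci ip A v v = 0"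
  shows "\<exists>c. \<forall>x y. ricci ip A x y = c * ip x y"
proof -
  let ?R = "\<lambda>i j. ricci ip A (e i) (e j)"
  have l: "linear (ricci ip A x)" "linear (\<lambda>x. ricci ip A x y)" for x y
    using bilinear_ricci by (auto simp: bilinear_def)
  note lin = l[THEN linear_add] l[THEN linear_cmul]
  have sw: "?R 2 1 = ?R 1 2" "?R 3 1 = ?R 1 3" "?R 4 1 = ?R 1 4" "?R 3 2 = ?R 2 3" "?R 4 2 = ?R 2 4" "?R 4 3 = ?R 3 4"
    by (rule ricci_sym)+
  have pm: "?R i i + ?R j j + 2 * a * ?R i j = 0" if "i \<in> {1, 2}" "j \<in> {3, 4}" "a \<in> {1, -1}" for i j a
  proof -
    have "ip (e i + a *\<^sub>R e j) (e i + a *\<^sub>R e j) = 0"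
      using that by (auto simp: ip_simps ip_basis_pair)
    then have "ricci ip A (e i + a *\<^sub>R e j) (e i + a *\<^sub>R e j) = 0" by (rule null)
    then show ?thesis using that(3) ricci_sym[of "e j" "e i"] by (auto simp: lin)
  qed
  have z: "?R 1 3 = 0" "?R 1 4 = 0" "?R 2 3 = 0" "?R 2 4 = 0" 
    "?R 1 1 = - ?R 3 3" "?R 2 2 = - ?R 3 3" "?R 4 4 = ?R 3 3"
    using pm[of 1 3 1] pm[of 1 3 "-1"] pm[of 1 4 1] pm[of 1 4 "-1"] pm[of 2 3 1] pm[of 2 3 "-1"]
      pm[of 2 4 1] pm[of 2 4 "-1"] by simp_all
  \<comment> \<open>The Pythagorean triple 3, 4, 5 gives null vectors that involve two frame vectors of the same causal character.\<close>
  have "ricci ip A (3 *\<^sub>R e 1 + 4 *\<^sub>R e 2 + 5 *\<^sub>R e 3) (3 *\<^sub>R e 1 + 4 *\<^sub>R e 2 + 5 *\<^sub>R e 3) = 0"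
    by (rule null) (simp add: ip_simps ip_basis_pair)
  then have 12: "?R 1 2 = 0" by (simp add: lin sw z)
  have "ricci ip A (5 *\<^sub>R e 1 + 3 *\<^sub>R e 3 + 4 *\<^sub>R e 4) (5 *\<^sub>R e 1 + 3 *\<^sub>R e 3 + 4 *\<^sub>R e 4) = 0"
    by (rule null) (simp add: ip_simps ip_basis_pair)
  then have 34: "?R 3 4 = 0" by (simp add: lin sw z)
  have "ricci ip A x y = ?R 3 3 * ip x y" for x y
    by (subst bilinear_expand[OF bilinear_ricci]) (simp add: sum_4 sw z 12 34 ip_coords algebra_simps)
  then show ?thesis by blast
qed

lemma pairing_add: "pairing (\<lambda>i j. T i j + T' i j) U = pairing T U + pairing T' U"
  "pairing U (\<lambda>i j. T i j + T' i j) = pairing U T + pairing U T'"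
  by (simp_all add: pairing_def sum.distrib algebra_simps)

lemma pairing_cmul:
  "pairing (\<lambda>i j. a * T i j) U = a * pairing T U"
  "pairing U (\<lambda>i j. a * T i j) = a * pairing U T"
  by (simp_all add: pairing_def sum_distrib_left mult_ac)

lemma pairing_sum: "pairing (\<lambda>i j. \<Sum>k\<in>(UNIV::3 set). T k i j) U = (\<Sum>k\<in>UNIV. pairing (T k) U)"
   "pairing U (\<lambda>i j. \<Sum>k\<in>(UNIV::3 set). T k i j) = (\<Sum>k\<in>UNIV. pairing U (T k))"
  by (simp_all add: sum_3 pairing_add)

lemma pairing_rank_one:
  "pairing (\<lambda>k l. form s i (e k) v * form s j (e l) v) (\<lambda>k l. form t m (e k) v * form t n (e l) v)
    = ip (rot s i v) (rot t m v) * ip (rot s j v) (rot t n v)"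
proof -
  have "ip (rot s i v) (rot t m v) = (\<Sum>k\<in>UNIV. \<eta> k * form s i (e k) v * form t m (e k) v)" for s t i m
    by (simp add: ip_coords co_rot sum_4)
  then show ?thesis by (simp add: pairing_def sum_product mult_ac)
qed

text \<open>For tensors built from the two-forms, traces of products reduce to the inner products of rotated
  vectors.\<close>

lemma pairing_blocks:
  "pairing (\<lambda>k l. \<Sum>i\<in>UNIV. \<Sum>j\<in>UNIV. a i j * (form s i (e k) v * form s j (e l) v))
     (\<lambda>k l. \<Sum>m\<in>UNIV. \<Sum>n\<in>UNIV. b m n * (form t m (e k) v * form t n (e l) v))
   = (\<Sum>i\<in>UNIV. \<Sum>j\<in>UNIV. \<Sum>m\<in>UNIV. \<Sum>n\<in>UNIV.
       a i j * (b m n * (ip (rot s i v) (rot t m v) * ip (rot s j v) (rot t n v))))"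
  by (simp only: pairing_sum pairing_cmul pairing_rank_one sum_distrib_left)

text \<open>In the coordinates \<open>x\<^sub>3 \<plusminus> x\<^sub>1\<close>, \<open>x\<^sub>4 \<plusminus> x\<^sub>2\<close> the squared length is \<open>(x\<^sub>3 - x\<^sub>1) (x\<^sub>3 + x\<^sub>1) + (x\<^sub>4 - x\<^sub>2) (x\<^sub>4 + x\<^sub>2)\<close>,
  that is, a determinant, and null vectors are the matrices of rank at most one. Here these four
  coordinates are twice \<open>q a\<close>, \<open>p b\<close>, \<open>- q b\<close> and \<open>p a\<close>.\<close>

definition null_vector :: "real \<Rightarrow> real \<Rightarrow> real \<Rightarrow> real \<Rightarrow> 'v" where
  "null_vector p q a b = (q * a - p * b) *\<^sub>R e 1 + (- q * b - p * a) *\<^sub>R e 2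
     + (q * a + p * b) *\<^sub>R e 3 + (p * a - q * b) *\<^sub>R e 4"

lemma co_null_vector:
  "co 1 (null_vector p q a b) = q * a - p * b" "co 2 (null_vector p q a b) = - q * b - p * a"
  "co 3 (null_vector p q a b) = q * a + p * b" "co 4 (null_vector p q a b) = p * a - q * b"
  by (simp_all add: null_vector_def)

lemma ip_null_vector: "ip (null_vector p q a b) (null_vector p q a b) = 0"
  by (simp add: ip_coords co_null_vector algebra_simps)

text \<open>The matrix of mixed inner products has rank one and separates the spinors \<open>(p, q)\<close> and \<open>(a, b)\<close>.
  This is what turns the trace of the squared Jacobi operator into a product.\<close>

lemma ip_rot_null_vector:
  "ip (rot 1 i (null_vector p q a b)) (rot (-1) j (null_vector p q a b)) = - 2 * cone p q i * cone a b j"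
  using exhaust_3[of i] exhaust_3[of j]
  by (elim disjE; simp add: ip_coords co_rot form_def Let_def co_null_vector cone_def; simp add: power2_eq_square algebra_simps)

lemma pairing_jac_null_vector:
  assumes ein: "\<And>x y. ricci ip A x y = c * ip x y"
  defines "Q \<equiv> \<lambda>s p q. (\<Sum>i\<in>UNIV. \<Sum>j\<in>UNIV. block s s i j * cone p q i * cone p q j)"
  shows "2 * pairing (jac (null_vector p q a b)) (jac (null_vector p q a b)) = Q 1 p q * Q (-1) a b"
proof -
  define v where "v = null_vector p q a b"
  define T where "T s k l = (\<Sum>i\<in>UNIV. \<Sum>j\<in>UNIV. block s s i j * (form s i (e k) v * form s j (e l) v))" for s k l
  have 0: "block 1 (-1) i j = 0" "block (-1) 1 i j = 0" for i j
    using mixed_block_zero[OF ein] block_sym by metis+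
  have jac: "jac v = (\<lambda>k l. (-1/4) * (T 1 k l + T (-1) k l))"
  proof (intro ext)
    fix k l
    show "jac v k l = (-1/4) * (T 1 k l + T (-1) k l)"
      unfolding jac_def
      by (subst A_blocks, simp add: 0 T_def sum_3 form_swap[of _ _ v "e l"], simp add: algebra_simps)
  qed
  have ip0: "ip v v = 0" by (simp add: v_def ip_null_vector)
  \<comment> \<open>Rotated vectors of the same family are pairwise orthogonal and null, so only the cross terms survive.\<close>
  have same: "pairing (T s) (T s) = 0" if "s \<in> {1, -1}" for s
    unfolding T_def pairing_blocks by (simp add: ip_rot_rot[OF that] ip0)
  have comm: "pairing (T (-1)) (T 1) = pairing (T 1) (T (-1))"
    by (simp add: pairing_def mult_ac)
  have "pairing (T 1) (T (-1)) = 4 * (Q 1 p q * Q (-1) a b)"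
    unfolding T_def pairing_blocks unfolding v_def ip_rot_null_vector Q_def
    by (simp add: sum_3 algebra_simps)
  then show ?thesis
    unfolding v_def[symmetric] jac pairing_cmul pairing_add by (simp add: same comm)
qed

lemma block_diagonal_if_null_traces:
  assumes ein: "\<And>x y. ricci ip A x y = c * ip x y"
    and null: "\<And>v. ip v v = 0 \<Longrightarrow> pairing (jac v) (jac v) = 0"
  shows "\<exists>s\<in>{1,-1}. \<exists>k. \<forall>i j. block s s i j = (if i = j then k * \<epsilon> i else 0)"
proof -
  let ?Q = "\<lambda>s p q. (\<Sum>i\<in>UNIV. \<Sum>j\<in>UNIV. block s s i j * cone p q i * cone p q j)"
  have prod: "?Q 1 p q * ?Q (-1) a b = 0" for p q a b
    using pairing_jac_null_vector[OF ein, of p q a b] null[OF ip_null_vector, of p q a b] by simp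
  have "\<exists>s\<in>{1,-1}. \<forall>p q. ?Q s p q = 0"
  proof (cases "\<forall>p q. ?Q 1 p q = 0")
    case False
    then obtain p q where "?Q 1 p q \<noteq> 0" by blast
    then have "?Q (-1) a b = 0" for a b using prod[of p q a b] by simp
    then show ?thesis by blast
  qed blast
  then obtain s where s: "s \<in> {1, -1}" "\<And>p q. ?Q s p q = 0" by blast
  have "block s s i j = (if i = j then block s s 1 1 * \<epsilon> i else 0)" for i j
    using quadratic_form_vanishing_on_cone[of "block s s" i j, OF block_sym s(2)] by (simp add: \<epsilon>_def)
  then show ?thesis using s(1) by blast
qed

end

section \<open>Equivalence of the Osserman conditions\<close>

context orthonormal_model
begin

text \<open>The third form also changes sign, since \<open>e\<^sub>1\<^sub>4\<close> and not \<open>e\<^sub>2\<^sub>3\<close> is affected by the reversal of \<open>e\<^sub>4\<close>.\<close>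

lemma block_flip:
  "orthonormal_model.block A flip s t i j =
    (if i = 3 then -1 else 1) * (if j = 3 then -1 else 1) * block (- s) (- t) i j"
proof -
  interpret f: orthonormal_model ip A flip
    using model orthonormal_flip by unfold_locales
  have neg: "A (- x) y z v = - A x y z v" "A x (- y) z v = - A x y z v" "A x y (- z) v = - A x y z v"
      "A x y z (- v) = - A x y z v" for x y z v
    by (rule A_linear[THEN linear_neg])+
  show ?thesis
    using exhaust_3[of i] exhaust_3[of j]
    by (elim disjE) (simp_all add: f.block_def f.component_def block_def component_def neg algebra_simps)
qed

text \<open>If the self-dual block is the scalar one, the frame with the reversed last vector represents the
  orientation for which the model is self-dual.\<close>

lemma einstein_self_dual_if_null_traces:
  assumes null: "\<And>v. v \<noteq> 0 \<Longrightarrow> ip v v = 0 \<Longrightarrow> ricci ip A v v = 0 \<and> pairing (jac v) (jac v) = 0"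
  shows "einstein ip A \<and> (\<exists>Or\<in>orientations. self_dual ip A Or)"
proof -
  \<comment> \<open>The zero vector is included because the parametrized null vectors may vanish.\<close>
  have null': "ricci ip A v v = 0" "pairing (jac v) (jac v) = 0" if "ip v v = 0" for v
    using null[OF _ that] traces_scale[of 0 v] by (cases "v = 0"; simp)+
  obtain c where ein: "\<And>x y. ricci ip A x y = c * ip x y"
    using einstein_if_ricci_null null' by blast
  obtain s k where s: "s \<in> {1, -1}" and k: "\<And>i j. block s s i j = (if i = j then k * \<epsilon> i else 0)"
    using block_diagonal_if_null_traces[OF ein null'(2)] by blast
  have "\<exists>Or\<in>orientations. self_dual ip A Or"
  proof (cases "s = -1")
    case True
    then have "self_dual ip A (same_orientation `` {e})"
      using k block_trace[OF ein] by (subst self_dual_iff_block[OF orientation_of_basis ein]) metis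
    then show ?thesis using orientation_of_basis(1) by blast
  next
    case False
    interpret f: orthonormal_model ip A flip
      using model orthonormal_flip by unfold_locales
    have k': "f.block (-1) (-1) i j = (if i = j then k * f.\<epsilon> i else 0)" for i j
      using False s k by (simp add: block_flip f.\<epsilon>_def \<epsilon>_def)
    then have "self_dual ip A (same_orientation `` {flip})"
      using f.block_trace[OF ein] by (subst f.self_dual_iff_block[OF f.orientation_of_basis ein]) metis
    then show ?thesis using f.orientation_of_basis(1) by blast
  qed
  then show ?thesis using ein by (auto simp: einstein_def)
qed

end

lemma osserman_if_einstein_self_dual:
  assumes "neutral_model ip A" "einstein ip A" "Or \<in> orientations" "self_dual ip A Or"
  shows "r \<noteq> 0 \<Longrightarrow> jordan_osserman_on {v. ip v v = r} ip A" "null_osserman ip A"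
proof -
  obtain e0 where "orthonormal_basis ip e0"
    using assms(1) by (auto simp: neutral_model_def neutral_inner_product_def)
  then interpret e0: orthonormal_model ip A e0
    using assms(1) by unfold_locales
  obtain e where e: "e \<in> Or" "orthonormal_basis ip e"
    using e0.orthonormal_basis_in_orientation[OF assms(3)] by blast
  interpret orthonormal_model ip A e
    using assms(1) e(2) by unfold_locales
  obtain c where ein: "\<And>x y. ricci ip A x y = c * ip x y"
    using assms(2) by (auto simp: einstein_def)
  have k: "block (-1) (-1) i j = (if i = j then - (2*c/3) * \<epsilon> i else 0)" for i j
    using self_dual_iff_block[OF assms(3) e(1) ein] assms(4) by blast
  note A = jacobi_form_if_block[OF ein k]
  show "jordan_osserman_on {v. ip v v = r} ip A" if "r \<noteq> 0"
    by (rule jordan_osserman_if_rot[OF A that])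
  show "null_osserman ip A"
    by (rule null_osserman_if_rot[OF A])
qed

theorem theorem1p1:
  fixes ip :: "'v::real_vector \<Rightarrow> 'v \<Rightarrow> real"
    and A :: "'v \<Rightarrow> 'v \<Rightarrow> 'v \<Rightarrow> 'v \<Rightarrow> real"
  assumes "neutral_model ip A"
  shows "(spacelike_osserman ip A \<longleftrightarrow> timelike_osserman ip A) \<and>
    (timelike_osserman ip A \<longleftrightarrow> spacelike_jordan_osserman ip A) \<and>
    (spacelike_jordan_osserman ip A \<longleftrightarrow> timelike_jordan_osserman ip A) \<and>
    (timelike_jordan_osserman ip A \<longleftrightarrow>
       einstein ip A \<and> (\<exists>Or \<in> orientations. self_dual ip A Or)) \<and>
    (einstein ip A \<and> (\<exists>Or \<in> orientations. self_dual ip A Or) \<longleftrightarrow> null_osserman ip A)"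
proof -
  let ?SD = "einstein ip A \<and> (\<exists>Or \<in> orientations. self_dual ip A Or)"
  obtain e where "orthonormal_basis ip e"
    using assms by (auto simp: neutral_model_def neutral_inner_product_def)
  then interpret orthonormal_model ip A e
    using assms by unfold_locales
  have "spacelike_osserman ip A \<Longrightarrow> ?SD"
    unfolding spacelike_osserman_def unit_spacelike_def
    by (intro einstein_self_dual_if_null_traces osserman_null_traces[of 1]) auto
  moreover have "timelike_osserman ip A \<Longrightarrow> ?SD"
    unfolding timelike_osserman_def unit_timelike_def
    by (intro einstein_self_dual_if_null_traces osserman_null_traces[of "-1"]) auto
  moreover have "null_osserman ip A \<Longrightarrow> ?SD"
    by (intro einstein_self_dual_if_null_traces null_osserman_null_traces)
  moreover have "?SD \<Longrightarrow> spacelike_jordan_osserman ip A"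
    unfolding spacelike_jordan_osserman_def unit_spacelike_def
    using osserman_if_einstein_self_dual(1)[OF assms, of _ 1] by auto
  moreover have "?SD \<Longrightarrow> timelike_jordan_osserman ip A"
    unfolding timelike_jordan_osserman_def unit_timelike_def
    using osserman_if_einstein_self_dual(1)[OF assms, of _ "-1"] by auto
  moreover have "?SD \<Longrightarrow> null_osserman ip A"
    using osserman_if_einstein_self_dual(2)[OF assms] by blast
  moreover have "spacelike_jordan_osserman ip A \<Longrightarrow> spacelike_osserman ip A"
    "timelike_jordan_osserman ip A \<Longrightarrow> timelike_osserman ip A"
    unfolding spacelike_jordan_osserman_def timelike_jordan_osserman_def spacelike_osserman_def timelike_osserman_def
    by (simp_all add: jordan_osserman_imp_osserman)
  ultimately show ?thesis by blast
qed

end
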